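(* Let $(M^4,g_{ij},f)$ be a complete gradient shrinking Ricci soliton of dimension $4$, i.e. $R_{ij}+\nabla_i\nabla_j f=\frac12 g_{ij}$, with vanishing $D_{ijk}$. Then the Weyl tensor $W_{ijkl}=0$ at all points where $\nabla f\neq 0$.
   Context: A complete gradient shrinking Ricci soliton $(M^n,g_{ij},f)$ is a complete Riemannian manifold $(M^n,g_{ij})$ together with a smooth function $f$ such that the Ricci tensor satisfies $R_{ij}+\nabla_i\nabla_j f=\frac12 g_{ij}$. Curvature convention: $R_{ik}=g^{jl}R_{ijkl}$, $R=g^{ik}R_{ik}$, and the round sphere has positive Ricci curvature. The Weyl tensor is $$W_{ijkl}=R_{ijkl}-\frac{1}{n-2}(g_{ik}R_{jl}-g_{il}R_{jk}-g_{jk}R_{il}+g_{jl}R_{ik})+\frac{R}{(n-1)(n-2)}(g_{ik}g_{jl}-g_{il}g_{jk}),$$ and the covariant 3-tensor $D_{ijk}$ is $$D_{ijk}=\frac{1}{n-2}(R_{jk}\nabla_i f-R_{ik}\nabla_j f)+\frac{1}{2(n-1)(n-2)}(g_{jk}\nabla_i R-g_{ik}\nabla_j R)-\frac{R}{(n-1)(n-2)}(g_{jk}\nabla_i f-g_{ik}\nabla_j f),$$ here with $n=4$. *)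

theory Defs
  imports "HOL-Analysis.Analysis"
begin

section \<open>Smooth functions on open subsets of Euclidean space\<close>

definition partial_deriv :: "'n::finite \<Rightarrow> (real^'n \<Rightarrow> real) \<Rightarrow> real^'n \<Rightarrow> real" where
  "partial_deriv i F x = deriv (\<lambda>t. F (x + t *\<^sub>R axis i 1)) 0"

fun iter_partial :: "'n::finite list \<Rightarrow> (real^'n \<Rightarrow> real) \<Rightarrow> real^'n \<Rightarrow> real" where
  "iter_partial [] F = F"
| "iter_partial (i # is) F = partial_deriv i (iter_partial is F)"

text \<open>
  For open \<open>S\<close> this is the class of \<open>C\<^sup>\<infinity>\<close> functions: differentiability of every iterated partial
  derivative makes all of them exist and be continuous.
\<close>

definition smooth_fun_on :: "(real^'n::finite) set \<Rightarrow> (real^'n \<Rightarrow> real) \<Rightarrow> bool" where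
  "smooth_fun_on S F \<longleftrightarrow> (\<forall>is. \<forall>x\<in>S. iter_partial is F differentiable (at x))"


section \<open>Smooth manifolds\<close>

text \<open>
  The manifold is the whole of a Hausdorff, second countable type \<open>'a\<close>. A chart is a pair of its
  domain and its coordinate map; the values of the coordinate map outside the domain are never used.
\<close>

type_synonym ('a, 'n) chart = "'a set \<times> ('a \<Rightarrow> real^'n)"

definition chart_inv :: "('a, 'n::finite) chart \<Rightarrow> real^'n \<Rightarrow> 'a" where
  "chart_inv c = inv_into (fst c) (snd c)"

definition is_chart :: "('a::topological_space, 'n::finite) chart \<Rightarrow> bool" where
  "is_chart c \<longleftrightarrow> open (fst c) \<and> open (snd c ` fst c) \<and>
     homeomorphism (fst c) (snd c ` fst c) (snd c) (chart_inv c)"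

definition smooth_atlas ::
  "('a::{t2_space, second_countable_topology}, 'n::finite) chart set \<Rightarrow> bool" where
  "smooth_atlas A \<longleftrightarrow>
     (\<forall>c\<in>A. is_chart c) \<and> (\<Union>c\<in>A. fst c) = UNIV \<and>
     (\<forall>c\<in>A. \<forall>d\<in>A. \<forall>k.
        smooth_fun_on (snd c ` (fst c \<inter> fst d)) (\<lambda>x. snd d (chart_inv c x) $ k))"

definition smooth_scalar_field ::
  "('a, 'n::finite) chart set \<Rightarrow> ('a \<Rightarrow> real) \<Rightarrow> bool" where
  "smooth_scalar_field A h \<longleftrightarrow> (\<forall>c\<in>A. smooth_fun_on (snd c ` fst c) (h \<circ> chart_inv c))"

text \<open>The coordinate vector field \<open>\<partial>\<^sub>i\<close> of the chart \<open>c\<close> acting on a function near \<open>p\<close>.\<close>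

definition coord_deriv ::
  "('a, 'n::finite) chart \<Rightarrow> 'n \<Rightarrow> ('a \<Rightarrow> real) \<Rightarrow> 'a \<Rightarrow> real" where
  "coord_deriv c i h p = partial_deriv i (h \<circ> chart_inv c) (snd c p)"


section \<open>Riemannian metrics\<close>

text \<open>
  A metric is given by its components: \<open>g c p $ i $ j\<close> is \<open>g(\<partial>\<^sub>i, \<partial>\<^sub>j)\<close> at \<open>p\<close> with respect to the
  chart \<open>c\<close>. The last clause is the transformation law of a covariant 2-tensor. All tensors below
  are likewise given by their components in a chart at a point of its domain.
\<close>

type_synonym ('a, 'n) metric_field = "('a, 'n) chart \<Rightarrow> 'a \<Rightarrow> real^'n^'n"

definition riemannian_metric ::
  "('a, 'n::finite) chart set \<Rightarrow> ('a, 'n) metric_field \<Rightarrow> bool" where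
  "riemannian_metric A g \<longleftrightarrow>
     (\<forall>c\<in>A. \<forall>i j. smooth_fun_on (snd c ` fst c) (\<lambda>x. g c (chart_inv c x) $ i $ j)) \<and>
     (\<forall>c\<in>A. \<forall>p\<in>fst c. transpose (g c p) = g c p \<and> (\<forall>v. v \<noteq> 0 \<longrightarrow> v \<bullet> (g c p *v v) > 0)) \<and>
     (\<forall>c\<in>A. \<forall>d\<in>A. \<forall>p\<in>fst c \<inter> fst d. \<forall>i j.
        g c p $ i $ j =
          (\<Sum>k\<in>UNIV. \<Sum>l\<in>UNIV. coord_deriv c i (\<lambda>q. snd d q $ k) p *
             coord_deriv c j (\<lambda>q. snd d q $ l) p * g d p $ k $ l))"

definition inv_metric ::
  "('a, 'n::finite) metric_field \<Rightarrow> ('a, 'n) chart \<Rightarrow> 'a \<Rightarrow> real^'n^'n" where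
  "inv_metric g c p = matrix_inv (g c p)"

text \<open>\<open>christoffel g c k i j p\<close> is \<open>\<Gamma>\<^sup>k\<^sub>i\<^sub>j\<close> of the Levi-Civita connection.\<close>

definition christoffel ::
  "('a, 'n::finite) metric_field \<Rightarrow> ('a, 'n) chart \<Rightarrow> 'n \<Rightarrow> 'n \<Rightarrow> 'n \<Rightarrow> 'a \<Rightarrow> real" where
  "christoffel g c k i j p =
     (1/2) * (\<Sum>l\<in>UNIV. inv_metric g c p $ k $ l *
       (coord_deriv c i (\<lambda>q. g c q $ j $ l) p + coord_deriv c j (\<lambda>q. g c q $ i $ l) p
        - coord_deriv c l (\<lambda>q. g c q $ i $ j) p))"

definition gradient ::
  "('a, 'n::finite) metric_field \<Rightarrow> ('a \<Rightarrow> real) \<Rightarrow> ('a, 'n) chart \<Rightarrow> 'a \<Rightarrow> real^'n" where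
  "gradient g f c p = (\<chi> i. \<Sum>j\<in>UNIV. inv_metric g c p $ i $ j * coord_deriv c j f p)"

text \<open>\<open>\<nabla>\<^sub>i\<nabla>\<^sub>j f\<close>\<close>

definition hessian ::
  "('a, 'n::finite) metric_field \<Rightarrow> ('a \<Rightarrow> real) \<Rightarrow> ('a, 'n) chart \<Rightarrow> 'n \<Rightarrow> 'n \<Rightarrow> 'a \<Rightarrow> real" where
  "hessian g f c i j p =
     coord_deriv c i (coord_deriv c j f) p
     - (\<Sum>k\<in>UNIV. christoffel g c k i j p * coord_deriv c k f p)"


section \<open>Completeness\<close>

definition geodesic ::
  "('a::topological_space, 'n::finite) chart set \<Rightarrow> ('a, 'n) metric_field \<Rightarrow> (real \<Rightarrow> 'a) \<Rightarrow> bool"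
where
  "geodesic A g \<gamma> \<longleftrightarrow> continuous_on UNIV \<gamma> \<and>
     (\<forall>c\<in>A. \<forall>t. \<gamma> t \<in> fst c \<longrightarrow>
        (\<exists>v. (\<forall>\<^sub>F s in nhds t. ((snd c \<circ> \<gamma>) has_vector_derivative v s) (at s)) \<and>
             (v has_vector_derivative
               (\<chi> k. - (\<Sum>i\<in>UNIV. \<Sum>j\<in>UNIV. christoffel g c k i j (\<gamma> t) * v t $ i * v t $ j))) (at t)))"

text \<open>Every initial point and initial velocity belong to a geodesic defined on all of \<open>\<real>\<close>.\<close>

definition geodesically_complete ::
  "('a::topological_space, 'n::finite) chart set \<Rightarrow> ('a, 'n) metric_field \<Rightarrow> bool" where
  "geodesically_complete A g \<longleftrightarrow>
     (\<forall>c\<in>A. \<forall>p\<in>fst c. \<forall>v.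
        \<exists>\<gamma>. geodesic A g \<gamma> \<and> \<gamma> 0 = p \<and> ((snd c \<circ> \<gamma>) has_vector_derivative v) (at 0))"


section \<open>Curvature\<close>

text \<open>
  \<open>riemann_up g c m i j l\<close> is the \<open>m\<close>-th component of
  \<open>\<nabla>\<^sub>i\<nabla>\<^sub>j \<partial>\<^sub>l - \<nabla>\<^sub>j\<nabla>\<^sub>i \<partial>\<^sub>l\<close>, and \<open>R\<^sub>i\<^sub>j\<^sub>k\<^sub>l\<close> is its inner product with \<open>\<partial>\<^sub>k\<close>. On a round unit sphere
  this gives \<open>R\<^sub>i\<^sub>j\<^sub>k\<^sub>l = g\<^sub>i\<^sub>k g\<^sub>j\<^sub>l - g\<^sub>i\<^sub>l g\<^sub>j\<^sub>k\<close>, hence \<open>R\<^sub>i\<^sub>k = g\<^sup>j\<^sup>l R\<^sub>i\<^sub>j\<^sub>k\<^sub>l = (n - 1) g\<^sub>i\<^sub>k\<close>.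
\<close>

definition riemann_up ::
  "('a, 'n::finite) metric_field \<Rightarrow> ('a, 'n) chart \<Rightarrow> 'n \<Rightarrow> 'n \<Rightarrow> 'n \<Rightarrow> 'n \<Rightarrow> 'a \<Rightarrow> real" where
  "riemann_up g c m i j l p =
     coord_deriv c i (christoffel g c m j l) p - coord_deriv c j (christoffel g c m i l) p
     + (\<Sum>s\<in>UNIV. christoffel g c s j l p * christoffel g c m i s p
                  - christoffel g c s i l p * christoffel g c m j s p)"

definition riemann ::
  "('a, 'n::finite) metric_field \<Rightarrow> ('a, 'n) chart \<Rightarrow> 'n \<Rightarrow> 'n \<Rightarrow> 'n \<Rightarrow> 'n \<Rightarrow> 'a \<Rightarrow> real" where
  "riemann g c i j k l p = (\<Sum>m\<in>UNIV. g c p $ k $ m * riemann_up g c m i j l p)"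

definition ricci ::
  "('a, 'n::finite) metric_field \<Rightarrow> ('a, 'n) chart \<Rightarrow> 'n \<Rightarrow> 'n \<Rightarrow> 'a \<Rightarrow> real" where
  "ricci g c i k p = (\<Sum>j\<in>UNIV. \<Sum>l\<in>UNIV. inv_metric g c p $ j $ l * riemann g c i j k l p)"

definition scalar_curv ::
  "('a, 'n::finite) metric_field \<Rightarrow> ('a, 'n) chart \<Rightarrow> 'a \<Rightarrow> real" where
  "scalar_curv g c p = (\<Sum>i\<in>UNIV. \<Sum>k\<in>UNIV. inv_metric g c p $ i $ k * ricci g c i k p)"

definition weyl ::
  "('a, 'n::finite) metric_field \<Rightarrow> ('a, 'n) chart \<Rightarrow> 'n \<Rightarrow> 'n \<Rightarrow> 'n \<Rightarrow> 'n \<Rightarrow> 'a \<Rightarrow> real" where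
  "weyl g c i j k l p = (let n = real CARD('n); G = g c p; Rc = (\<lambda>a b. ricci g c a b p) in
     riemann g c i j k l p
     - 1 / (n - 2) * (G$i$k * Rc j l - G$i$l * Rc j k - G$j$k * Rc i l + G$j$l * Rc i k)
     + scalar_curv g c p / ((n - 1) * (n - 2)) * (G$i$k * G$j$l - G$i$l * G$j$k))"

definition D_tensor ::
  "('a, 'n::finite) metric_field \<Rightarrow> ('a \<Rightarrow> real) \<Rightarrow> ('a, 'n) chart \<Rightarrow> 'n \<Rightarrow> 'n \<Rightarrow> 'n \<Rightarrow> 'a \<Rightarrow> real"
where
  "D_tensor g f c i j k p = (let n = real CARD('n); G = g c p; Rc = (\<lambda>a b. ricci g c a b p);
       df = (\<lambda>a. coord_deriv c a f p); dR = (\<lambda>a. coord_deriv c a (scalar_curv g c) p) in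
     1 / (n - 2) * (Rc j k * df i - Rc i k * df j)
     + 1 / (2 * (n - 1) * (n - 2)) * (G$j$k * dR i - G$i$k * dR j)
     - scalar_curv g c p / ((n - 1) * (n - 2)) * (G$j$k * df i - G$i$k * df j))"


section \<open>Gradient shrinking Ricci solitons\<close>

definition complete_gradient_shrinking_soliton ::
  "('a::{t2_space, second_countable_topology}, 'n::finite) chart set \<Rightarrow>
   ('a, 'n) metric_field \<Rightarrow> ('a \<Rightarrow> real) \<Rightarrow> bool" where
  "complete_gradient_shrinking_soliton A g f \<longleftrightarrow>
     smooth_atlas A \<and> riemannian_metric A g \<and> geodesically_complete A g \<and>
     smooth_scalar_field A f \<and>
     (\<forall>c\<in>A. \<forall>p\<in>fst c. \<forall>i j. ricci g c i j p + hessian g f c i j p = (1/2) * g c p $ i $ j)"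

end

(*
  Write v = grad f, w = df and F = |w|^2.  The trace of D = 0 gives dR = 2 Ric(v, .); contracting
  D = 0 with v then gives, where w is nonzero, Ric(v, .) = lambda w and Ric = mu g + nu w w.
  Hence Hess f = (1/2 - mu) g - nu w w, and the Ricci identity expresses
    R_ijkl v^l = nabla_i nabla_j nabla_k f - nabla_j nabla_i nabla_k f
  as a_i g_jk - a_j g_ik - (b_i w_j - b_j w_i) w_k for some covectors a and b = d nu.  This is killed by
  v^k and has jk-trace -lambda w_i, which forces it to be -(lambda/3) (w_i g_jk - w_j g_ik); so
  W_ijkl v^l = 0.  In an orthonormal frame whose first vector is parallel to v only the components of W
  on the 3-dimensional complement survive, and there trace-freeness leaves nothing.
*)
theory Submission imports Defs begin

section \<open>Iterated partial derivatives\<close>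

text \<open>Only \<open>g\<close>, \<open>f\<close> and their iterated coordinate derivatives are
  treated as smooth; for products, quotients and the inverse metric, first-order differentiability
  is all that is established. This rations derivatives: \<open>ricci\<close> already contains
  derivatives of \<open>christoffel\<close>, and it can be differentiated because the soliton
  equation rewrites it as half the metric minus the Hessian of \<open>f\<close>. The derivatives of
  the Ricci eigenvalues in the Ricci identity are never computed. They enter as unknown covectors,
  and linear algebra at one point eliminates them. The derivative of the scalar curvature is
  likewise an unknown, fixed by D itself and not by a differentiated Bianchi identity. The
  eigenvalue formulas divide by the squared length of the gradient, so the splitting of the Hessian
  has to be secured on a whole neighbourhood before it may be differentiated.\<close>

lemma partial_deriv_eq:
  fixes F :: "real^'n::finite \<Rightarrow> real"
  assumes "(F has_derivative F') (at x)"
  shows "((\<lambda>t. F (x + t *\<^sub>R axis i 1)) has_field_derivative F' (axis i 1)) (at 0)"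
    and "partial_deriv i F x = F' (axis i 1)"
proof -
  interpret F': bounded_linear F' using assms by (rule has_derivative_bounded_linear)
  have "((\<lambda>t. F (x + t *\<^sub>R axis i 1)) has_derivative (\<lambda>t. F' (t *\<^sub>R axis i 1))) (at 0)"
    by (rule has_derivative_compose[where g = F]) (auto intro!: derivative_eq_intros assms)
  then show *: "((\<lambda>t. F (x + t *\<^sub>R axis i 1)) has_field_derivative F' (axis i 1)) (at 0)"
    by (simp add: has_field_derivative_def F'.scaleR mult_commute_abs)
  then show "partial_deriv i F x = F' (axis i 1)"
    unfolding partial_deriv_def by (rule DERIV_imp_deriv)
qed

lemma partial_deriv_line:
  fixes F :: "real^'n::finite \<Rightarrow> real"
  assumes "F differentiable (at (x + s *\<^sub>R axis i 1))"
  shows "((\<lambda>t. F (x + t *\<^sub>R axis i 1)) has_field_derivative partial_deriv i F (x + s *\<^sub>R axis i 1)) (at s)"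
proof -
  obtain F' where F': "(F has_derivative F') (at (x + s *\<^sub>R axis i 1))"
    using assms by (auto simp: differentiable_def)
  have "((\<lambda>t. F (x + s *\<^sub>R axis i 1 + t *\<^sub>R axis i 1)) has_field_derivative F' (axis i 1)) (at (s - s))"
    using partial_deriv_eq(1)[OF F'] by simp
  then have "((\<lambda>t. F (x + s *\<^sub>R axis i 1 + (t - s) *\<^sub>R axis i 1)) has_field_derivative F' (axis i 1)) (at s)"
    by (rule DERIV_chain2[where g = "\<lambda>t. t - s" and Db = 1, simplified]) (auto intro!: derivative_eq_intros)
  moreover have "x + s *\<^sub>R axis i 1 + (t - s) *\<^sub>R axis i 1 = x + t *\<^sub>R axis i 1" for t
    by (simp add: algebra_simps)
  ultimately show ?thesis
    using partial_deriv_eq(2)[OF F'] by simp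
qed

lemma partial_deriv_cong_ev:
  assumes "\<forall>\<^sub>F y in nhds x. F y = G y"
  shows "partial_deriv i F x = partial_deriv i G x"
proof -
  have "((\<lambda>t. x + t *\<^sub>R axis i 1) \<longlongrightarrow> x + 0 *\<^sub>R axis i 1) (nhds (0::real))"
    by (intro tendsto_intros filterlim_ident)
  then have "\<forall>\<^sub>F t in nhds (0::real). F (x + t *\<^sub>R axis i 1) = G (x + t *\<^sub>R axis i 1)"
    using assms by (auto dest: eventually_compose_filterlim)
  then show ?thesis
    unfolding partial_deriv_def by (intro deriv_cong_ev) auto
qed

text \<open>The second difference does not change when \<open>i\<close> and \<open>j\<close> are
  exchanged, so evaluating its limit in both ways makes mixed derivatives commute. Differentiability
  of the first derivatives suffices, without continuity of the second ones.\<close>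

lemma second_difference_tendsto:
  fixes F :: "real^'n::finite \<Rightarrow> real"
  assumes F: "\<forall>\<^sub>F y in nhds x. F differentiable (at y)"
    and P: "partial_deriv i F differentiable (at x)"
  shows "((\<lambda>t. (F (x + t *\<^sub>R axis i 1 + t *\<^sub>R axis j 1) - F (x + t *\<^sub>R axis i 1)
                - F (x + t *\<^sub>R axis j 1) + F x) / t\<^sup>2)
          \<longlongrightarrow> partial_deriv j (partial_deriv i F) x) (at_right 0)"
proof -
  let ?P = "partial_deriv i F"
  let ?a = "axis i 1 :: real^'n" and ?b = "axis j 1 :: real^'n"
  obtain L where L: "(?P has_derivative L) (at x)"
    using P by (auto simp: differentiable_def)
  interpret L: bounded_linear L using L by (rule has_derivative_bounded_linear)
  have Lb: "partial_deriv j ?P x = L ?b"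
    by (rule partial_deriv_eq(2)[OF L])
  obtain d where d: "d > 0" "\<And>y. dist y x < d \<Longrightarrow> F differentiable (at y)"
    using F by (auto simp: eventually_nhds_metric)
  show ?thesis
    unfolding Lb
  proof (rule tendstoI)
    fix e :: real assume "e > 0"
    then have e4: "e / 4 > 0" by simp
    obtain r where r: "r > 0"
      "\<And>y. norm (y - x) < r \<Longrightarrow> norm (?P y - ?P x - L (y - x)) \<le> e / 4 * norm (y - x)"
      using L[unfolded has_derivative_at_alt] e4 by meson
    \<comment> \<open>All points in use lie within \<open>2 * t\<close> of \<open>x\<close>, hence
      the factor 2.\<close>
    define m where "m = min d r / 2"
    have m: "m > 0" using d r by (simp add: m_def)
    have "dist ((F (x + t *\<^sub>R ?a + t *\<^sub>R ?b) - F (x + t *\<^sub>R ?a) - F (x + t *\<^sub>R ?b) + F x) / t\<^sup>2) (L ?b) < e"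
      if t: "0 < t" "t < m" for t
    proof -
      \<comment> \<open>With the step along \<open>j\<close> frozen, the second difference is an
        increment along \<open>i\<close> alone, which the mean value theorem turns into a difference
        of two values of \<open>?P\<close>.\<close>
      define \<phi> where "\<phi> s = F ((x + t *\<^sub>R ?b) + s *\<^sub>R ?a) - F (x + s *\<^sub>R ?a)" for s
      have near: "norm (s *\<^sub>R ?a + u *\<^sub>R ?b) \<le> s + u" if "0 \<le> s" "0 \<le> u" for s u
        using norm_triangle_ineq[of "s *\<^sub>R ?a" "u *\<^sub>R ?b"] that by simp
      have bd: "s + u < d" "s + u < r" if "s \<le> t" "u \<le> t" for s u
        using that t by (auto simp: m_def)
      have der: "(\<phi> has_field_derivative (?P ((x + t *\<^sub>R ?b) + s *\<^sub>R ?a) - ?P (x + s *\<^sub>R ?a))) (at s)"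
        if s: "0 \<le> s" "s \<le> t" for s
        unfolding \<phi>_def
      proof (intro DERIV_diff partial_deriv_line)
        show "F differentiable (at (x + t *\<^sub>R ?b + s *\<^sub>R ?a))"
          using near[of s t] bd(1)[of s t] s t
          by (intro d) (auto simp: dist_norm algebra_simps)
        show "F differentiable (at (x + s *\<^sub>R ?a))"
          using near[of s 0] bd(1)[of s 0] s t
          by (intro d) (auto simp: dist_norm algebra_simps)
      qed
      obtain z where z: "0 < z" "z < t"
        "\<phi> t - \<phi> 0 = (t - 0) * (?P ((x + t *\<^sub>R ?b) + z *\<^sub>R ?a) - ?P (x + z *\<^sub>R ?a))"
        using MVT2[of 0 t \<phi> "\<lambda>s. ?P ((x + t *\<^sub>R ?b) + s *\<^sub>R ?a) - ?P (x + s *\<^sub>R ?a)"] der t by auto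
      \<comment> \<open>Linearisation errors of \<open>?P\<close> at the two points. In their
        difference the unknown \<open>z\<close> cancels and the linear part leaves
        \<open>t * L ?b\<close>.\<close>
      define A where "A = ?P ((x + t *\<^sub>R ?b) + z *\<^sub>R ?a) - ?P x - L (z *\<^sub>R ?a + t *\<^sub>R ?b)"
      define B where "B = ?P (x + z *\<^sub>R ?a) - ?P x - L (z *\<^sub>R ?a)"
      have "\<bar>A\<bar> \<le> e / 4 * norm (z *\<^sub>R ?a + t *\<^sub>R ?b)"
        using r(2)[of "(x + t *\<^sub>R ?b) + z *\<^sub>R ?a"] near[of z t] bd(2)[of z t] z t
        by (simp add: A_def algebra_simps)
      also have "\<dots> \<le> e / 4 * (t + t)"
        using near[of z t] z t e4 by (intro mult_left_mono) auto
      finally have A: "\<bar>A\<bar> \<le> e / 2 * t" by simp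
      have "\<bar>B\<bar> \<le> e / 4 * norm (z *\<^sub>R ?a)"
        using r(2)[of "x + z *\<^sub>R ?a"] near[of z 0] bd(2)[of z 0] z t
        by (simp add: B_def algebra_simps)
      also have "\<dots> \<le> e / 4 * t"
        using z t e4 by (intro mult_left_mono) auto
      finally have B: "\<bar>B\<bar> \<le> e / 4 * t" .
      have "(F (x + t *\<^sub>R ?a + t *\<^sub>R ?b) - F (x + t *\<^sub>R ?a) - F (x + t *\<^sub>R ?b) + F x) = \<phi> t - \<phi> 0"
        by (simp add: \<phi>_def algebra_simps)
      also have "\<dots> = t * (A - B + t * L ?b)"
        by (simp add: z(3) A_def B_def L.add L.scaleR)
      finally have "(F (x + t *\<^sub>R ?a + t *\<^sub>R ?b) - F (x + t *\<^sub>R ?a) - F (x + t *\<^sub>R ?b) + F x) / t\<^sup>2 - L ?b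
          = (A - B) / t"
        using t by (simp only: add_divide_distrib distrib_left power2_eq_square) simp
      moreover have "\<bar>A - B\<bar> < e * t"
      proof -
        have "e / 2 * t + e / 4 * t < e * t" using \<open>e > 0\<close> t by (simp add: field_simps)
        then show ?thesis using A B by linarith
      qed
      then have "\<bar>(A - B) / t\<bar> < e"
        using t by (simp add: field_simps)
      ultimately show ?thesis
        by (simp only: dist_norm real_norm_def)
    qed
    then show "\<forall>\<^sub>F t in at_right 0. dist ((F (x + t *\<^sub>R ?a + t *\<^sub>R ?b) - F (x + t *\<^sub>R ?a)
        - F (x + t *\<^sub>R ?b) + F x) / t\<^sup>2) (L ?b) < e"
      using m by (auto simp: eventually_at_right_field)
  qed
qed

lemma partial_deriv_commute:
  fixes F :: "real^'n::finite \<Rightarrow> real"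
  assumes "\<forall>\<^sub>F y in nhds x. F differentiable (at y)"
    and "partial_deriv i F differentiable (at x)" "partial_deriv j F differentiable (at x)"
  shows "partial_deriv i (partial_deriv j F) x = partial_deriv j (partial_deriv i F) x"
proof (rule tendsto_unique[OF _ second_difference_tendsto[OF assms(1,3)]])
  show "((\<lambda>t. (F (x + t *\<^sub>R axis j 1 + t *\<^sub>R axis i 1) - F (x + t *\<^sub>R axis j 1)
                - F (x + t *\<^sub>R axis i 1) + F x) / t\<^sup>2)
          \<longlongrightarrow> partial_deriv j (partial_deriv i F) x) (at_right 0)"
    using second_difference_tendsto[OF assms(1,2), of j] by (simp add: algebra_simps)
qed simp

lemma iter_partial_cong:
  assumes "open S" "\<And>x. x \<in> S \<Longrightarrow> F x = G x" "x \<in> S"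
  shows "iter_partial is F x = iter_partial is G x"
  using assms(3)
proof (induction "is" arbitrary: x)
  case (Cons i "is")
  have "\<forall>\<^sub>F y in nhds x. iter_partial is F y = iter_partial is G y"
    using eventually_nhds_in_open[OF assms(1) Cons.prems] by eventually_elim (rule Cons.IH)
  then show ?case by (auto intro: partial_deriv_cong_ev)
qed (use assms in auto)

lemma differentiable_transform_open:
  assumes "open S" "x \<in> S" "\<And>y. y \<in> S \<Longrightarrow> F y = G y" "F differentiable (at x)"
  shows "G differentiable (at x)"
  using assms has_derivative_transform_within_open[of F _ x UNIV S G]
  unfolding differentiable_def by auto

text \<open>The head of the list is differentiated last, so a derivative taken beforehand is an
  index at the end.\<close>

lemma iter_partial_snoc: "iter_partial (is @ [i]) F = iter_partial is (partial_deriv i F)"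
  by (induction "is") auto

text \<open>\<open>G\<close> may differ from the derivative off \<open>S\<close>: a coordinate
  derivative read through \<open>chart_inv\<close> is a partial derivative only on the image of the
  chart.\<close>

lemma smooth_fun_on_partial_deriv:
  assumes "open S" "smooth_fun_on S F" "\<And>x. x \<in> S \<Longrightarrow> G x = partial_deriv i F x"
  shows "smooth_fun_on S G"
  unfolding smooth_fun_on_def
proof safe
  fix "is" x assume x: "x \<in> S"
  have "iter_partial is (partial_deriv i F) differentiable (at x)"
    using assms(2) x unfolding smooth_fun_on_def iter_partial_snoc[symmetric] by blast
  then show "iter_partial is G differentiable (at x)"
    by (rule differentiable_transform_open[OF assms(1) x, rotated])
       (rule iter_partial_cong[OF assms(1)], simp_all add: assms(3))
qed

section \<open>Differentiability of the inverse matrix\<close>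

text \<open>Cramer's rule for a unit vector on the right-hand side. It turns the entries of the
  inverse into quotients of polynomials in the entries of \<open>M\<close>, which differentiate
  without further theory.\<close>

lemma matrix_inv_cramer:
  fixes M :: "real^'n^'n"
  assumes "det M \<noteq> 0"
  shows "matrix_inv M $ k $ l = det (\<chi> i j. if j = k then axis l 1 $ i else M $ i $ j) / det M"
proof -
  have "invertible M" using assms by (simp add: invertible_det_nz)
  then have "M ** matrix_inv M = mat 1"
    unfolding invertible_def matrix_inv_def by (rule someI2_ex) simp
  then have "M *v (matrix_inv M *v axis l 1) = axis l 1"
    by (simp add: matrix_vector_mul_assoc)
  then have "matrix_inv M *v axis l 1 = (\<chi> k. det (\<chi> i j. if j = k then axis l 1 $ i else M $ i $ j) / det M)"
    using cramer[OF assms] by blast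
  moreover have "matrix_inv M *v axis l 1 = column l (matrix_inv M)"
    by (simp add: matrix_vector_mult_basis)
  ultimately show ?thesis
    by (metis (no_types, lifting) column_def vec_lambda_beta)
qed

lemma differentiable_det:
  fixes M :: "'a::real_normed_vector \<Rightarrow> real^'n^'n"
  assumes "\<And>i j. (\<lambda>x. M x $ i $ j) differentiable (at x)"
  shows "(\<lambda>x. det (M x)) differentiable (at x)"
proof -
  have "(\<lambda>x. \<Prod>i\<in>S. M x $ i $ p i) differentiable (at x)" for p S
    by (induction S rule: infinite_finite_induct) (auto intro!: differentiable_mult assms)
  then show ?thesis unfolding det_def by (auto intro!: differentiable_sum differentiable_mult finite_permutations)
qed

lemma differentiable_matrix_inv:
  fixes M :: "real^'m::finite \<Rightarrow> real^'n^'n"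
  assumes "\<And>i j. (\<lambda>x. M x $ i $ j) differentiable (at x)" "open S" "x \<in> S"
    and "\<And>y. y \<in> S \<Longrightarrow> det (M y) \<noteq> 0"
  shows "(\<lambda>x. matrix_inv (M x) $ k $ l) differentiable (at x)"
proof (rule differentiable_transform_open[OF assms(2,3)])
  show "(\<lambda>x. det (\<chi> i j. if j = k then axis l 1 $ i else M x $ i $ j) / det (M x)) differentiable (at x)"
  proof (intro differentiable_divide differentiable_det)
    show "(\<lambda>x. (\<chi> i j. if j = k then axis l 1 $ i else M x $ i $ j) $ i $ j) differentiable (at x)" for i j
      using assms(1)[of i j] by (cases "j = k") simp_all
  qed (use assms in auto)
qed (simp add: matrix_inv_cramer assms)

section \<open>Tensor algebra at a point\<close>

text \<open>The classical octahedron argument: the Bianchi identity at the four cyclic shifts of the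
  indices. The cycle in \<open>B\<close> leaves out \<open>k\<close>, the slot of the lowered
  index.\<close>

lemma curvature_pair_symmetry:
  fixes R :: "'i \<Rightarrow> 'i \<Rightarrow> 'i \<Rightarrow> 'i \<Rightarrow> real"
  assumes 1: "\<And>i j k l. R i j k l = - R j i k l"
    and 2: "\<And>i j k l. R i j k l = - R i j l k"
    and B: "\<And>i j k l. R i j k l + R j l k i + R l i k j = 0"
  shows "R i j k l = R k l i j"
  using B[of i j k l] B[of j k l i] B[of k l i j] B[of l i j k]
    1[of i j k l] 1[of j l k i] 1[of l i k j] 1[of j k l i] 1[of k i l j] 1[of i j l k]
    1[of k l i j] 1[of l j i k] 1[of j k i l] 1[of l i j k] 1[of i k j l] 1[of k l j i]
    2[of i j k l] 2[of j l k i] 2[of l i k j] 2[of j k l i] 2[of k i l j] 2[of i j l k]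
    2[of k l i j] 2[of l j i k] 2[of j k i l] 2[of l i j k] 2[of i k j l] 2[of k l j i]
  by linarith

section \<open>Contractions and traces with a metric at one point\<close>

text \<open>A constant of its own and not a bare sum, so that linearity and metric contractions work
  as simp rules on a tensor expression abstracted in one slot.\<close>

definition contract :: "('n::finite \<Rightarrow> real) \<Rightarrow> ('n \<Rightarrow> real) \<Rightarrow> real" where
  "contract v X = (\<Sum>k\<in>UNIV. X k * v k)"

lemma contract_linear [simp]:
  "contract v (\<lambda>k. X k + Y k) = contract v X + contract v Y"
  "contract v (\<lambda>k. X k - Y k) = contract v X - contract v Y"
  "contract v (\<lambda>k. - X k) = - contract v X"
  "contract v (\<lambda>k. a * X k) = a * contract v X"
  "contract v (\<lambda>k. X k * a) = contract v X * a"
  "contract v (\<lambda>k. X k / a) = contract v X / a"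
  "contract v (\<lambda>k. 0) = 0"
  by (simp_all add: contract_def algebra_simps sum.distrib sum_subtractf sum_distrib_left sum_negf
      sum_divide_distrib)

text \<open>
  A metric at one point in coordinates, \<open>K\<close> being the inverse of \<open>G\<close>; \<open>tr X\<close> is \<open>g\<^sup>j\<^sup>l X\<^sub>j\<^sub>l\<close>.
\<close>

locale metric_components =
  fixes G K :: "'n::finite \<Rightarrow> 'n \<Rightarrow> real"
  assumes G_sym: "G i j = G j i"
    and K_sym: "K i j = K j i"
    and KG: "(\<Sum>k\<in>UNIV. K i k * G k j) = (if i = j then 1 else 0)"
begin

definition raise :: "('n \<Rightarrow> real) \<Rightarrow> 'n \<Rightarrow> real" where
  "raise w i = (\<Sum>j\<in>UNIV. K i j * w j)"

definition tr :: "('n \<Rightarrow> 'n \<Rightarrow> real) \<Rightarrow> real" where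
  "tr X = (\<Sum>j\<in>UNIV. \<Sum>l\<in>UNIV. K j l * X j l)"

lemma tr_linear [simp]:
  "tr (\<lambda>j l. X j l + Y j l) = tr X + tr Y"
  "tr (\<lambda>j l. X j l - Y j l) = tr X - tr Y"
  "tr (\<lambda>j l. - X j l) = - tr X"
  "tr (\<lambda>j l. a * X j l) = a * tr X"
  "tr (\<lambda>j l. X j l * a) = tr X * a"
  "tr (\<lambda>j l. X j l / a) = tr X / a"
  by (simp_all add: tr_def algebra_simps sum.distrib sum_subtractf sum_distrib_left sum_negf
      sum_divide_distrib)

lemma tr_transpose: "tr (\<lambda>j l. X l j) = tr X"
  unfolding tr_def by (subst sum.swap) (simp add: K_sym)

lemma sum_delta_mult: "(\<Sum>i\<in>UNIV. (if i = k then 1 else 0) * X i) = (X (k::'n) :: real)"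
  by (simp add: if_distrib[where f = "\<lambda>x. x * _"] cong: if_cong)

lemma tr_metric_mult: "tr (\<lambda>j l. G i l * X j) = X i"
proof -
  have "tr (\<lambda>j l. G i l * X j) = (\<Sum>j\<in>UNIV. (\<Sum>l\<in>UNIV. K j l * G l i) * X j)"
    by (simp add: tr_def sum_distrib_left sum_distrib_right G_sym[of i] mult_ac)
  then show ?thesis by (simp only: KG sum_delta_mult)
qed

text \<open>One pattern for each order of the factors and indices, so that the simplifier evaluates
  traces without rearranging terms.\<close>

lemma tr_metric_mult_variants [simp]:
  "tr (\<lambda>j l. G i l * X j) = X i" "tr (\<lambda>j l. G l i * X j) = X i"
  "tr (\<lambda>j l. G i j * X l) = X i" "tr (\<lambda>j l. G j i * X l) = X i"
  "tr (\<lambda>j l. X j * G i l) = X i" "tr (\<lambda>j l. X j * G l i) = X i"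
  "tr (\<lambda>j l. X l * G i j) = X i" "tr (\<lambda>j l. X l * G j i) = X i"
  using tr_metric_mult[of i X] tr_transpose[of "\<lambda>j l. G i l * X j"]
  by (simp_all add: G_sym[of _ i] mult.commute[of "X _"])

lemma tr_metric [simp]: "tr (\<lambda>j l. G j l) = CARD('n)"
proof -
  have "tr (\<lambda>j l. G j l) = (\<Sum>j\<in>UNIV. \<Sum>l\<in>UNIV. K j l * G l j)"
    unfolding tr_def by (intro sum.cong refl) (simp add: G_sym[of _ j] G_sym)
  then show ?thesis by (simp only: KG) simp
qed

lemma tr_product [simp]: "tr (\<lambda>j l. w j * z l) = contract (raise w) z"
  unfolding tr_def contract_def raise_def
  by (subst sum.swap) (simp add: sum_distrib_left K_sym mult_ac)

lemma tr_product' [simp]: "tr (\<lambda>j l. w l * z j) = contract (raise w) z"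
  using tr_product[of w z] tr_transpose[of "\<lambda>j l. w j * z l"] by simp

lemma contract_raise_metric [simp]:
  "contract (raise w) (\<lambda>j. G i j) = w i" "contract (raise w) (\<lambda>j. G j i) = w i"
proof -
  have "contract (raise w) (G i) = tr (\<lambda>j l. w j * G i l)" by (simp only: tr_product)
  also have "\<dots> = w i" by (rule tr_metric_mult_variants)
  finally show "contract (raise w) (\<lambda>j. G i j) = w i" .
  then show "contract (raise w) (\<lambda>j. G j i) = w i" by (simp add: G_sym[of _ i])
qed

lemma contract_raise_commute:
  "contract (raise w) z = contract (raise z) w"
  using tr_product[of w z] tr_product'[of z w] by (simp add: mult.commute)

end

locale metric_components_4 = metric_components G K for G K :: "4 \<Rightarrow> 4 \<Rightarrow> real" +
  fixes w :: "4 \<Rightarrow> real"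
  assumes w_nonnull: "contract (raise w) w \<noteq> 0"
begin

text \<open>\<open>dR\<close> is an arbitrary covector here. The coefficients are those of a
  symmetric form with eigenvalue \<open>l\<close> along \<open>w\<close> whose three other
  directions share \<open>tr Rc - l\<close> equally; the coefficient of \<open>w j * w k\<close>
  makes up the difference of the two eigenvalues, divided by \<open>F\<close>.\<close>

lemma ricci_from_D_zero:
  assumes sym: "\<And>i j. Rc i j = Rc j i"
    and D: "\<And>i j k. 1/2 * (Rc j k * w i - Rc i k * w j) + 1/12 * (G j k * dR i - G i k * dR j)
              - tr Rc / 6 * (G j k * w i - G i k * w j) = 0"
  defines "F \<equiv> contract (raise w) w"
    and "l \<equiv> contract (raise w) (\<lambda>j. contract (raise w) (Rc j)) / contract (raise w) w"
  shows "contract (raise w) (Rc i) = l * w i"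
    and "Rc j k = (tr Rc - l) / 3 * G j k + (4 * l - tr Rc) / (3 * F) * (w j * w k)"
proof -
  define r where "r i = contract (raise w) (Rc i)" for i
  have r: "contract (raise w) (\<lambda>k. Rc i k) = r i" "contract (raise w) (\<lambda>k. Rc k i) = r i" for i
    by (simp_all add: r_def sym[of _ i])
  have F: "F \<noteq> 0" using w_nonnull by (simp add: F_def)
  have lF: "contract (raise w) r = l * F"
    using F by (simp add: l_def F_def r_def[abs_def])
  \<comment> \<open>The last bracket has trace \<open>3 * w i\<close>, and 3/6 cancels the
    \<open>tr Rc\<close> coming from the first bracket.\<close>
  have "tr (\<lambda>j k. 1/2 * (Rc j k * w i - Rc i k * w j) + 1/12 * (G j k * dR i - G i k * dR j)
              - tr Rc / 6 * (G j k * w i - G i k * w j)) = 0" for i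
    unfolding D by (simp add: tr_def)
  then have "1/2 * (tr Rc * w i - r i) + 1/12 * (4 * dR i - dR i)
              - tr Rc / 6 * (4 * w i - w i) = 0" for i
    by (simp add: r contract_raise_commute[of "Rc _" w])
  then have dR: "dR i = 2 * r i" for i
    by (simp add: field_simps)
  \<comment> \<open>With \<open>dR\<close> inserted, the first two brackets combine to 1/2 - 1/6 =
    1/3 times \<open>r j * w i - r i * w j\<close>, and the third bracket contracts to zero; so
    \<open>r\<close> and \<open>w\<close> are parallel.\<close>
  have "contract (raise w) (\<lambda>k. 1/2 * (Rc j k * w i - Rc i k * w j) + 1/12 * (G j k * dR i - G i k * dR j)
              - tr Rc / 6 * (G j k * w i - G i k * w j)) = 0" for i j
    unfolding D by (simp add: contract_def)
  then have "1/2 * (r j * w i - r i * w j) + 1/12 * (w j * (2 * r i) - w i * (2 * r j)) = 0" for i j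
    by (simp add: r dR mult.commute[of "w _" "w _"])
  then have rw: "r j * w i - r i * w j = 0" for i j
    by (simp add: field_simps)
  have "contract (raise w) (\<lambda>j. r j * w i - r i * w j) = 0" for i
    unfolding rw by (simp add: contract_def)
  then have "F * (l * w i) = F * r i" for i
    by (simp add: lF F_def[symmetric] algebra_simps)
  then have rl: "r i = l * w i" for i
    using F by simp
  then show "contract (raise w) (Rc i) = l * w i"
    by (simp add: r_def)
  have "contract (raise w) (\<lambda>i. 1/2 * (Rc j k * w i - Rc i k * w j) + 1/12 * (G j k * dR i - G i k * dR j)
              - tr Rc / 6 * (G j k * w i - G i k * w j)) = 0"
    unfolding D by (simp add: contract_def)
  then have "1/2 * (Rc j k * F - l * w k * w j) + 1/12 * (G j k * (2 * (l * F)) - w k * (2 * (l * w j)))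
      - tr Rc / 6 * (G j k * F - w k * w j) = 0"
    by (simp add: r dR rl F_def)
  then show "Rc j k = (tr Rc - l) / 3 * G j k + (4 * l - tr Rc) / (3 * F) * (w j * w k)"
    using F by (simp add: field_simps)
qed

text \<open>The unknowns \<open>a\<close> and \<open>b\<close> satisfy two linear systems, from the
  contraction and from the trace. Together they make \<open>a\<close>, then \<open>b\<close>,
  parallel to \<open>w\<close>; the term with \<open>b\<close> drops out and the trace fixes the one
  scalar that is left.\<close>

lemma curvature_contraction_rigid:
  assumes T: "\<And>i j k. T i j k = a i * G j k - a j * G i k - (b i * w j - b j * w i) * w k"
    and Tw: "\<And>i j. contract (raise w) (T i j) = 0"
    and trT: "\<And>i. tr (T i) = - l * w i"
  shows "T i j k = - (l / 3) * (w i * G j k - w j * G i k)"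
proof -
  define F where "F = contract (raise w) w"
  define av where "av = contract (raise w) a"
  define bv where "bv = contract (raise w) b"
  have F: "F \<noteq> 0" using w_nonnull by (simp add: F_def)
  have "contract (raise w) (\<lambda>k. a i * G j k - a j * G i k - (b i * w j - b j * w i) * w k) = 0" for i j
    using Tw[of i j] by (simp add: T[abs_def])
  then have 1: "a i * w j - a j * w i - (b i * w j - b j * w i) * F = 0" for i j
    by (simp add: F_def)
  have "contract (raise w) (\<lambda>j. a i * w j - a j * w i - (b i * w j - b j * w i) * F) = 0" for i
    unfolding 1 by (simp add: contract_def)
  then have 2: "a i * F - av * w i - (b i * F - bv * w i) * F = 0" for i
    by (simp add: F_def[symmetric] av_def bv_def)
  have "tr (\<lambda>j k. a i * G j k - a j * G i k - (b i * (w j * w k) - w i * (b j * w k))) = - l * w i" for i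
    unfolding trT[of i, symmetric] by (intro arg_cong[where f = tr] ext) (simp add: T algebra_simps)
  then have 3: "3 * a i - (b i * F - bv * w i) = - l * w i" for i
    by (simp add: F_def bv_def contract_raise_commute[of b w] algebra_simps)
  \<comment> \<open>Eliminating \<open>b i * F - bv * w i\<close> between \<open>2\<close> and
    \<open>3\<close> leaves \<open>- 2 * F * a i = (av + l * F) * w i\<close>.\<close>
  define m where "m = - (av / F + l) / 2"
  have am: "a i = m * w i" for i
    using 2[of i] arg_cong[OF 3[of i], of "\<lambda>x. F * x"] F unfolding m_def by (simp add: field_simps)
  have bm: "b i * F = (3 * m + bv + l) * w i" for i
    using 3[of i] by (simp add: am algebra_simps)
  have "b i * w j - b j * w i = 0" for i j
  proof -
    have "F * (b i * w j - b j * w i) = (b i * F) * w j - (b j * F) * w i"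
      by (simp add: algebra_simps)
    then show ?thesis using F by (simp add: bm)
  qed
  then have Tm: "T i j k = m * (w i * G j k - w j * G i k)" for i j k
    by (simp add: T am algebra_simps)
  obtain i0 where i0: "w i0 \<noteq> 0"
    using F unfolding F_def contract_def by (metis (no_types, lifting) mult_zero_left sum.neutral)
  have "tr (T i0) = m * (3 * w i0)"
    by (simp add: Tm[abs_def] algebra_simps)
  then have "w i0 * (3 * m + l) = 0"
    using trT[of i0] by (simp add: algebra_simps)
  then have "m = - (l / 3)"
    using i0 by simp
  then show ?thesis by (simp add: Tm)
qed

end

section \<open>Weyl-type tensors in dimension four\<close>

text \<open>Gram-Schmidt without projections: a vector that is Euclidean-orthogonal to the image of
  \<open>S\<close> under \<open>G\<close> is orthogonal to \<open>S\<close> for the metric, and a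
  dimension count provides one while fewer than four vectors are chosen.\<close>

lemma orthonormal_frame_4:
  fixes G :: "real^4^4" and v :: "real^4"
  assumes sym: "transpose G = G" and pos: "\<And>x. x \<noteq> 0 \<Longrightarrow> x \<bullet> (G *v x) > 0" and v: "v \<noteq> 0"
  obtains u :: "4 \<Rightarrow> real^4" where
    "\<And>a b. u a \<bullet> (G *v u b) = (if a = b then 1 else 0)" "\<exists>s. u 1 = s *\<^sub>R v"
proof -
  have G: "x \<bullet> (G *v y) = y \<bullet> (G *v x)" for x y
    by (metis dot_lmul_matrix inner_commute sym transpose_matrix_vector)
  have normal: "\<exists>s. (s *\<^sub>R x) \<bullet> (G *v (s *\<^sub>R x)) = 1" if "x \<noteq> 0" for x
    using pos[OF that]
    by (intro exI[of _ "1 / sqrt (x \<bullet> (G *v x))"])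
       (simp add: matrix_vector_mult_scaleR field_simps)
  have next_vec: "\<exists>x. x \<bullet> (G *v x) = 1 \<and> (\<forall>y\<in>S. x \<bullet> (G *v y) = 0)" if "finite S" "card S < 4" for S
  proof -
    have "dim ((*v) G ` S) < DIM(real^4)"
      using dim_le_card'[of "(*v) G ` S"] card_image_le[OF that(1), of "(*v) G"] that by simp
    then obtain x where x: "x \<noteq> 0" "\<And>y. y \<in> span ((*v) G ` S) \<Longrightarrow> orthogonal x y"
        by (rule orthogonal_to_subspace_exists) blast
    obtain s where s: "(s *\<^sub>R x) \<bullet> (G *v (s *\<^sub>R x)) = 1" using normal[OF x(1)] by blast
    have "(s *\<^sub>R x) \<bullet> (G *v y) = 0" if "y \<in> S" for y
      using x(2)[of "G *v y"] that by (auto simp: orthogonal_def span_base)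
    with s show ?thesis by blast
  qed
  have flip: "y \<bullet> (G *v x) = 0" if "x \<bullet> (G *v y) = 0" for x y
    using that G[of x y] by simp
  obtain s where u1: "(s *\<^sub>R v) \<bullet> (G *v (s *\<^sub>R v)) = 1" using normal[OF v] by blast
  define u1 where "u1 = s *\<^sub>R v"
  obtain u2 where u2: "u2 \<bullet> (G *v u2) = 1" "u2 \<bullet> (G *v u1) = 0"
    using next_vec[of "{u1}"] by auto
  have c3: "card {u1, u2} < 4" by (simp add: card_insert_if)
  obtain u3 where u3: "u3 \<bullet> (G *v u3) = 1" "u3 \<bullet> (G *v u1) = 0" "u3 \<bullet> (G *v u2) = 0"
    using next_vec[OF _ c3] by auto
  have c4: "card {u1, u2, u3} < 4" by (simp add: card_insert_if)
  obtain u4 where u4: "u4 \<bullet> (G *v u4) = 1" "u4 \<bullet> (G *v u1) = 0" "u4 \<bullet> (G *v u2) = 0"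
      "u4 \<bullet> (G *v u3) = 0"
    using next_vec[OF _ c4] by auto
  define u :: "4 \<Rightarrow> real^4" where "u a = (if a = 1 then u1 else if a = 2 then u2 else if a = 3 then u3 else u4)" for a
  have "\<forall>a b. u a \<bullet> (G *v u b) = (if a = b then 1 else 0)"
    unfolding forall_4 using u1 u2 u3 u4 flip[OF u2(2)] flip[OF u3(2)] flip[OF u3(3)]
      flip[OF u4(2)] flip[OF u4(3)] flip[OF u4(4)]
    by (simp add: u_def u1_def[symmetric])
  moreover have "u 1 = s *\<^sub>R v" by (simp add: u_def u1_def)
  ultimately show thesis using that by blast
qed

text \<open>On the indices 2, 3, 4 the trace is a 3 by 3 matrix. Each off-diagonal entry is a single
  component of \<open>W\<close>; the diagonal entries are the pairwise sums of three numbers, and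
  these all vanish only if the three numbers do.\<close>

lemma antisymmetric_trace_free_3_vanishes:
  fixes W :: "4 \<Rightarrow> 4 \<Rightarrow> 4 \<Rightarrow> 4 \<Rightarrow> real"
  assumes 1: "\<And>a b c d. W a b c d = - W b a c d" and 2: "\<And>a b c d. W a b c d = - W a b d c"
    and 3: "\<And>b c d. W 1 b c d = 0" and 4: "\<And>a b d. W a b 1 d = 0"
    and tr: "\<And>a c. (\<Sum>b\<in>UNIV. W a b c b) = 0"
  shows "W a b c d = 0"
proof -
  \<comment> \<open>Antisymmetry and the vanishing at index 1 reduce the sixteen index pairs to
    three; this serves both pairs of slots.\<close>
  have pairs: "\<forall>a b. Q a b" if "\<And>a. Q a a" "\<And>a b. Q a b \<Longrightarrow> Q b a" "\<And>b. Q 1 b" "Q 2 3" "Q 2 4" "Q 3 4"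
    for Q :: "4 \<Rightarrow> 4 \<Rightarrow> bool"
    unfolding forall_4
    by (simp add: that(1,3-) that(2)[OF that(3)] that(2)[OF that(4)] that(2)[OF that(5)] that(2)[OF that(6)])
  have d1: "W a a c d = 0" for a c d using 1[of a a c d] by simp
  have d2: "W a b c c = 0" for a b c using 2[of a b c c] by simp
  have z2: "W a 1 c d = 0" for a c d using 1[of a 1 c d] 3 by simp
  have z4: "W a b c 1 = 0" for a b c using 2[of a b c 1] 4 by simp
  have t: "W a 2 c 2 + W a 3 c 3 + W a 4 c 4 = 0" for a c
    using tr[of a c] unfolding sum_4 by (simp add: z2)
  have flip: "W b a d c = W a b c d" for a b c d
    using 1[of b a d c] 2[of a b d c] by simp
  have "W 2 3 2 3 + W 2 4 2 4 = 0" "W 3 2 3 2 + W 3 4 3 4 = 0" "W 4 2 4 2 + W 4 3 4 3 = 0"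
    using t[of 2 2] t[of 3 3] t[of 4 4] by (simp_all add: d1 d2)
  then have "W 2 3 2 3 = 0 \<and> W 2 4 2 4 = 0 \<and> W 3 4 3 4 = 0"
    using flip[of 3 2 3 2] flip[of 4 2 4 2] flip[of 4 3 4 3] by linarith
  moreover have "W 2 4 3 4 = 0" "W 3 4 2 4 = 0" "W 2 3 4 3 = 0" "W 4 3 2 3 = 0" "W 3 2 4 2 = 0" "W 4 2 3 2 = 0"
    using t[of 2 3] t[of 3 2] t[of 2 4] t[of 4 2] t[of 3 4] t[of 4 3] by (simp_all add: d1 d2)
  ultimately have vals: "W 2 3 2 3 = 0" "W 2 4 2 4 = 0" "W 3 4 3 4 = 0" "W 2 3 2 4 = 0" "W 2 3 3 4 = 0"
     "W 2 4 2 3 = 0" "W 2 4 3 4 = 0" "W 3 4 2 3 = 0" "W 3 4 2 4 = 0"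
    using flip[of 2 3 2 4] flip[of 2 4 2 3] 2[of 2 3 3 4] 1[of 3 4 2 3] by simp_all
  have neg1: "W b a c d = 0" if "W a b c d = 0" for a b c d
    using that 1[of b a c d] by simp
  have neg2: "W a b d c = 0" if "W a b c d = 0" for a b c d
    using that 2[of a b d c] by simp
  have "\<forall>a b. W a b c d = 0" if "W 2 3 c d = 0" "W 2 4 c d = 0" "W 3 4 c d = 0" for c d
    by (rule pairs[of "\<lambda>a b. W a b c d = 0"], rule d1, erule neg1, rule 3) (rule that)+
  moreover have "\<forall>c d. W 2 3 c d = 0"
    by (rule pairs[of "\<lambda>c d. W 2 3 c d = 0"], rule d2, erule neg2, rule 4) (rule vals)+
  moreover have "\<forall>c d. W 2 4 c d = 0"
    by (rule pairs[of "\<lambda>c d. W 2 4 c d = 0"], rule d2, erule neg2, rule 4) (rule vals)+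
  moreover have "\<forall>c d. W 3 4 c d = 0"
    by (rule pairs[of "\<lambda>c d. W 3 4 c d = 0"], rule d2, erule neg2, rule 4) (rule vals)+
  ultimately show ?thesis by blast
qed

lemma sum_rotate3:
  "(\<Sum>i\<in>A. \<Sum>j\<in>B. \<Sum>k\<in>C. X i j k) = (\<Sum>k\<in>C. \<Sum>i\<in>A. \<Sum>j\<in>B. X i j k)"
proof -
  have "(\<Sum>i\<in>A. \<Sum>j\<in>B. \<Sum>k\<in>C. X i j k) = (\<Sum>i\<in>A. \<Sum>k\<in>C. \<Sum>j\<in>B. X i j k)"
    by (intro sum.cong refl sum.swap)
  also have "\<dots> = (\<Sum>k\<in>C. \<Sum>i\<in>A. \<Sum>j\<in>B. X i j k)"
    by (rule sum.swap)
  finally show ?thesis .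
qed

lemma sum_rotate4:
  "(\<Sum>i\<in>A. \<Sum>j\<in>B. \<Sum>k\<in>C. \<Sum>l\<in>D. X i j k l)
    = (\<Sum>j\<in>B. \<Sum>k\<in>C. \<Sum>l\<in>D. \<Sum>i\<in>A. X i j k l)"
  by (subst sum.swap, intro sum.cong refl, subst sum.swap, intro sum.cong refl, rule sum.swap)

lemma weyl_type_vanishes_4:
  fixes W :: "4 \<Rightarrow> 4 \<Rightarrow> 4 \<Rightarrow> 4 \<Rightarrow> real" and G K :: "real^4^4" and v :: "real^4"
  assumes sym: "transpose G = G" and pos: "\<And>x. x \<noteq> 0 \<Longrightarrow> x \<bullet> (G *v x) > 0" and v: "v \<noteq> 0"
    and KG: "K ** G = mat 1"
    and 1: "\<And>i j k l. W i j k l = - W j i k l" and 2: "\<And>i j k l. W i j k l = - W i j l k"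
    and pair: "\<And>i j k l. W i j k l = W k l i j"
    and tr: "\<And>i k. (\<Sum>j\<in>UNIV. \<Sum>l\<in>UNIV. K $ j $ l * W i j k l) = 0"
    and Wv: "\<And>i j k. (\<Sum>l\<in>UNIV. W i j k l * v $ l) = 0"
  shows "W i j k l = 0"
proof -
  obtain u :: "4 \<Rightarrow> real^4" and s where
    u: "\<And>a b. u a \<bullet> (G *v u b) = (if a = b then 1 else 0)" and u1: "u 1 = s *\<^sub>R v"
    using orthonormal_frame_4[OF sym pos v] by metis
  define U :: "real^4^4" where "U = (\<chi> a. u a)"
  \<comment> \<open>Orthonormality of the rows of \<open>U\<close>. A one-sided inverse of a square
    matrix is two-sided, so \<open>U\<close> can be moved to the other end, which expresses the
    inverse metric through the frame.\<close>
  have "U ** (G ** transpose U) = mat 1"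
    by (simp add: vec_eq_iff mat_def matrix_matrix_mult_def U_def transpose_def u[symmetric] 
       inner_vec_def matrix_vector_mult_def)
  then have "(G ** transpose U) ** U = mat 1"
    by (simp add: matrix_left_right_inverse)
  then have "K ** ((G ** transpose U) ** U) = K" by simp
  then have UK: "transpose U ** U = K"
    by (simp add: matrix_mul_assoc KG)
  then have K: "K $ j $ l = (\<Sum>b\<in>UNIV. u b $ j * u b $ l)" for j l
    by (auto simp: matrix_matrix_mult_def U_def transpose_def)
  \<comment> \<open>The frame detects covectors: vanishing on all \<open>u a\<close> gives zero
    after multiplication by \<open>K\<close>, and \<open>K\<close> is invertible.\<close>
  have nondeg: "X i = 0" if "\<And>a. (\<Sum>i\<in>UNIV. X i * u a $ i) = 0" for X :: "4 \<Rightarrow> real" and i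
  proof -
    have "(\<Sum>i\<in>UNIV. X i * K $ i $ l) = (\<Sum>b\<in>UNIV. (\<Sum>i\<in>UNIV. X i * u b $ i) * u b $ l)" for l
      unfolding K sum_distrib_left sum_distrib_right by (subst sum.swap) (simp add: mult_ac)
    then have "(\<chi> i. X i) v* K = 0"
      by (simp add: that vec_eq_iff vector_matrix_mult_def mult.commute)
    then have "((\<chi> i. X i) v* K) v* G = 0" by simp
    then show "X i = 0"
      by (simp add: vector_matrix_mul_assoc KG vec_eq_iff)
  qed
  define V where "V a b c d = (\<Sum>i\<in>UNIV. \<Sum>j\<in>UNIV. \<Sum>k\<in>UNIV. \<Sum>l\<in>UNIV.
      W i j k l * (u a $ i * u b $ j * u c $ k * u d $ l))" for a b c d
  have V: "V a b c d = (\<Sum>i\<in>UNIV. (\<Sum>j\<in>UNIV. (\<Sum>k\<in>UNIV. (\<Sum>l\<in>UNIV.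
      W i j k l * u d $ l) * u c $ k) * u b $ j) * u a $ i)" for a b c d
    unfolding V_def sum_distrib_left sum_distrib_right by (simp add: mult_ac)
  have "V a b c d = - V b a c d" for a b c d
  proof -
    have "V a b c d = (\<Sum>j\<in>UNIV. \<Sum>i\<in>UNIV. \<Sum>k\<in>UNIV. \<Sum>l\<in>UNIV.
        W i j k l * (u a $ i * u b $ j * u c $ k * u d $ l))"
      unfolding V_def by (rule sum.swap)
    also have "\<dots> = - V b a c d"
      unfolding V_def sum_negf[symmetric] by (intro sum.cong refl, subst 1) simp
    finally show ?thesis .
  qed
  moreover have V2: "V a b c d = - V a b d c" for a b c d
  proof -
    have "V a b c d = (\<Sum>i\<in>UNIV. \<Sum>j\<in>UNIV. \<Sum>l\<in>UNIV. \<Sum>k\<in>UNIV.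
        W i j k l * (u a $ i * u b $ j * u c $ k * u d $ l))"
      unfolding V_def by (intro sum.cong refl sum.swap)
    also have "\<dots> = - V a b d c"
      unfolding V_def sum_negf[symmetric] by (intro sum.cong refl, subst 2) simp
    finally show ?thesis .
  qed
  moreover have Wu: "(\<Sum>l\<in>UNIV. W i j k l * u 1 $ l) = 0" for i j k
    using Wv[of i j k] by (simp add: u1 mult.left_commute sum_distrib_left[symmetric])
  then have "V a b c 1 = 0" for a b c
    by (simp add: V)
  then have "V a b 1 d = 0" for a b d
    using V2[of a b 1 d] by simp
  moreover have "V 1 b c d = 0" for b c d
  proof -
    \<comment> \<open>Pair symmetry carries the null direction from the last slot to the
      first.\<close>
    have "(\<Sum>i\<in>UNIV. W i j k l * u 1 $ i) = 0" for j k l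
      using Wu[of k l j] 2[of k l j] pair[of _ j k l] by (simp add: sum_negf)
    then have "(\<Sum>j\<in>UNIV. \<Sum>k\<in>UNIV. \<Sum>l\<in>UNIV. (\<Sum>i\<in>UNIV. W i j k l * u 1 $ i) * (u b $ j * u c $ k * u d $ l)) = 0"
      by simp
    also have "(\<Sum>j\<in>UNIV. \<Sum>k\<in>UNIV. \<Sum>l\<in>UNIV. (\<Sum>i\<in>UNIV. W i j k l * u 1 $ i) * (u b $ j * u c $ k * u d $ l)) = V 1 b c d"
      unfolding V_def sum_distrib_right by (subst sum_rotate4) (simp add: mult_ac)
    finally show ?thesis .
  qed
  moreover have "(\<Sum>b\<in>UNIV. V a b c b) = 0" for a c
  proof -
    have "(\<Sum>b\<in>UNIV. V a b c b) = (\<Sum>i\<in>UNIV. \<Sum>k\<in>UNIV. (\<Sum>j\<in>UNIV. \<Sum>l\<in>UNIV. K $ j $ l * W i j k l) * (u a $ i * u c $ k))"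
    proof -
      have "(\<Sum>b\<in>UNIV. V a b c b) = (\<Sum>i\<in>UNIV. \<Sum>b\<in>UNIV. \<Sum>j\<in>UNIV. \<Sum>k\<in>UNIV. \<Sum>l\<in>UNIV.
          W i j k l * (u a $ i * u b $ j * u c $ k * u b $ l))"
        unfolding V_def by (rule sum.swap)
      also have "\<dots> = (\<Sum>i\<in>UNIV. \<Sum>j\<in>UNIV. \<Sum>k\<in>UNIV. \<Sum>l\<in>UNIV. \<Sum>b\<in>UNIV.
          W i j k l * (u a $ i * u b $ j * u c $ k * u b $ l))"
        by (intro sum.cong refl sum_rotate4)
      also have "\<dots> = (\<Sum>i\<in>UNIV. \<Sum>j\<in>UNIV. \<Sum>k\<in>UNIV. \<Sum>l\<in>UNIV. K $ j $ l * W i j k l * (u a $ i * u c $ k))"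
        unfolding K sum_distrib_right by (simp add: mult_ac)
      also have "\<dots> = (\<Sum>i\<in>UNIV. \<Sum>k\<in>UNIV. \<Sum>j\<in>UNIV. \<Sum>l\<in>UNIV. K $ j $ l * W i j k l * (u a $ i * u c $ k))"
        by (intro sum.cong refl sum.swap)
      finally show ?thesis by (simp add: sum_distrib_right)
    qed
    then show ?thesis by (simp add: tr)
  qed
  ultimately have "V a b c d = 0" for a b c d
    using antisymmetric_trace_free_3_vanishes[of V] by blast
  \<comment> \<open>The nested form of \<open>V\<close> lets \<open>nondeg\<close> strip one frame
    vector at a time, starting with the first slot.\<close>
  then have "(\<Sum>j\<in>UNIV. (\<Sum>k\<in>UNIV. (\<Sum>l\<in>UNIV. W i j k l * u d $ l) * u c $ k) * u b $ j) = 0" for b c d i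
    unfolding V by (rule nondeg)
  then have "(\<Sum>k\<in>UNIV. (\<Sum>l\<in>UNIV. W i j k l * u d $ l) * u c $ k) = 0" for c d i j
    by (rule nondeg)
  then have "(\<Sum>l\<in>UNIV. W i j k l * u d $ l) = 0" for d i j k
    by (rule nondeg)
  then show ?thesis by (rule nondeg)
qed

section \<open>Differential geometry in one chart\<close>

definition smooth_in_chart :: "('a, 'n::finite) chart \<Rightarrow> ('a \<Rightarrow> real) \<Rightarrow> bool" where
  "smooth_in_chart c h \<longleftrightarrow> smooth_fun_on (snd c ` fst c) (h \<circ> chart_inv c)"

text \<open>First-order differentiability at one point is closed under arithmetic by standard rules,
  which spares a closure theory for \<open>smooth_fun_on\<close>.\<close>

definition diff_in_chart :: "('a, 'n::finite) chart \<Rightarrow> ('a \<Rightarrow> real) \<Rightarrow> 'a \<Rightarrow> bool" where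
  "diff_in_chart c h p \<longleftrightarrow> (h \<circ> chart_inv c) differentiable (at (snd c p))"

lemma diff_in_chart_intros:
  "diff_in_chart c (\<lambda>q. a) p"
  "diff_in_chart c h p \<Longrightarrow> diff_in_chart c k p \<Longrightarrow> diff_in_chart c (\<lambda>q. h q + k q) p"
  "diff_in_chart c h p \<Longrightarrow> diff_in_chart c k p \<Longrightarrow> diff_in_chart c (\<lambda>q. h q - k q) p"
  "diff_in_chart c h p \<Longrightarrow> diff_in_chart c k p \<Longrightarrow> diff_in_chart c (\<lambda>q. h q * k q) p"
  "(\<And>i. diff_in_chart c (H i) p) \<Longrightarrow> diff_in_chart c (\<lambda>q. \<Sum>i\<in>UNIV. H (i::'i::finite) q) p"
  by (simp_all add: diff_in_chart_def o_def)

lemma coord_deriv_eqI: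
  assumes "((h \<circ> chart_inv c) has_derivative h') (at (snd c p))"
  shows "coord_deriv c i h p = h' (axis i 1)"
  unfolding coord_deriv_def by (rule partial_deriv_eq(2)[OF assms])

lemma diff_in_chartE:
  assumes "diff_in_chart c h p"
  obtains h' where "((h \<circ> chart_inv c) has_derivative h') (at (snd c p))"
    "\<And>i. coord_deriv c i h p = h' (axis i 1)"
  using assms coord_deriv_eqI unfolding diff_in_chart_def differentiable_def by metis

lemma coord_deriv_const: "coord_deriv c i (\<lambda>q. a) p = 0"
  by (rule coord_deriv_eqI[where h' = "\<lambda>_. 0"]) (simp add: o_def)

lemma coord_deriv_add:
  assumes "diff_in_chart c h p" "diff_in_chart c k p"
  shows "coord_deriv c i (\<lambda>q. h q + k q) p = coord_deriv c i h p + coord_deriv c i k p"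
proof -
  obtain h' k' where "((h \<circ> chart_inv c) has_derivative h') (at (snd c p))"
      "coord_deriv c i h p = h' (axis i 1)"
      "((k \<circ> chart_inv c) has_derivative k') (at (snd c p))"
      "coord_deriv c i k p = k' (axis i 1)"
    using assms by (metis diff_in_chartE)
  then show ?thesis
    using coord_deriv_eqI[of "\<lambda>q. h q + k q" c "\<lambda>x. h' x + k' x" p] by (simp add: o_def has_derivative_add)
qed

lemma coord_deriv_diff:
  assumes "diff_in_chart c h p" "diff_in_chart c k p"
  shows "coord_deriv c i (\<lambda>q. h q - k q) p = coord_deriv c i h p - coord_deriv c i k p"
proof -
  obtain h' k' where "((h \<circ> chart_inv c) has_derivative h') (at (snd c p))"
      "coord_deriv c i h p = h' (axis i 1)"
      "((k \<circ> chart_inv c) has_derivative k') (at (snd c p))"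
      "coord_deriv c i k p = k' (axis i 1)"
    using assms by (metis diff_in_chartE)
  then show ?thesis
    using coord_deriv_eqI[of "\<lambda>q. h q - k q" c "\<lambda>x. h' x - k' x" p] by (simp add: o_def has_derivative_diff)
qed

lemma coord_deriv_sum:
  assumes "\<And>s. diff_in_chart c (H s) p"
  shows "coord_deriv c i (\<lambda>q. \<Sum>s\<in>UNIV. H (s::'i::finite) q) p = (\<Sum>s\<in>UNIV. coord_deriv c i (H s) p)"
proof -
  have "\<exists>H'. ((H s \<circ> chart_inv c) has_derivative H') (at (snd c p)) \<and> coord_deriv c i (H s) p = H' (axis i 1)" for s
    using assms by (metis diff_in_chartE)
  then obtain H' where "\<And>s. ((H s \<circ> chart_inv c) has_derivative H' s) (at (snd c p))"
      "\<And>s. coord_deriv c i (H s) p = H' s (axis i 1)"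
    by metis
  then show ?thesis
    using coord_deriv_eqI[of "\<lambda>q. \<Sum>s\<in>UNIV. H s q" c "\<lambda>x. \<Sum>s\<in>UNIV. H' s x" p] by (simp add: o_def has_derivative_sum)
qed

locale chart_domain =
  fixes c :: "('a::topological_space, 'n::finite) chart"
  assumes chart: "is_chart c"
begin

lemma open_image: "open (snd c ` fst c)"
  using chart by (simp add: is_chart_def)

lemma chart_inv_chart [simp]: "p \<in> fst c \<Longrightarrow> chart_inv c (snd c p) = p"
  using chart by (simp add: is_chart_def homeomorphism_def)

lemma coord_deriv_mult:
  assumes "p \<in> fst c" "diff_in_chart c h p" "diff_in_chart c k p"
  shows "coord_deriv c i (\<lambda>q. h q * k q) p = h p * coord_deriv c i k p + coord_deriv c i h p * k p"
proof -
  obtain h' k' where "((h \<circ> chart_inv c) has_derivative h') (at (snd c p))"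
      "coord_deriv c i h p = h' (axis i 1)"
      "((k \<circ> chart_inv c) has_derivative k') (at (snd c p))"
      "coord_deriv c i k p = k' (axis i 1)"
    using assms by (metis diff_in_chartE)
  moreover from this have "(((\<lambda>q. h q * k q) \<circ> chart_inv c) has_derivative
      (\<lambda>x. h p * k' x + h' x * k p)) (at (snd c p))"
    using has_derivative_mult[of "h \<circ> chart_inv c" h' "snd c p" UNIV "k \<circ> chart_inv c" k'] assms(1)
    by (simp add: o_def)
  ultimately show ?thesis
    by (simp add: coord_deriv_eqI)
qed

lemma diff_in_chart_divide:
  assumes "p \<in> fst c" "diff_in_chart c h p" "diff_in_chart c k p" "k p \<noteq> 0"
  shows "diff_in_chart c (\<lambda>q. h q / k q) p"
  using assms by (simp add: diff_in_chart_def o_def)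

lemma eventually_in_chart:
  assumes "p \<in> fst c" "\<And>q. q \<in> fst c \<Longrightarrow> P q"
  shows "\<forall>\<^sub>F x in nhds (snd c p). P (chart_inv c x)"
proof -
  have "\<forall>\<^sub>F x in nhds (snd c p). x \<in> snd c ` fst c"
    using assms(1) open_image by (intro eventually_nhds_in_open) auto
  then show ?thesis by eventually_elim (auto simp: assms(2))
qed

lemma coord_deriv_cong_ev:
  assumes "\<forall>\<^sub>F x in nhds (snd c p). h (chart_inv c x) = k (chart_inv c x)"
  shows "coord_deriv c i h p = coord_deriv c i k p"
  unfolding coord_deriv_def using assms by (intro partial_deriv_cong_ev) simp

lemma coord_deriv_cong:
  assumes "p \<in> fst c" "\<And>q. q \<in> fst c \<Longrightarrow> h q = k q"
  shows "coord_deriv c i h p = coord_deriv c i k p"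
  using assms by (intro coord_deriv_cong_ev eventually_in_chart)

lemma diff_in_chart_cong:
  assumes "p \<in> fst c" "\<And>q. q \<in> fst c \<Longrightarrow> h q = k q" "diff_in_chart c h p"
  shows "diff_in_chart c k p"
  unfolding diff_in_chart_def
  by (rule differentiable_transform_open[OF open_image _ _ assms(3)[unfolded diff_in_chart_def]])
     (use assms(1,2) in auto)

lemma smooth_imp_diff_in_chart:
  assumes "smooth_in_chart c h" "p \<in> fst c"
  shows "diff_in_chart c h p"
proof -
  have "iter_partial [] (h \<circ> chart_inv c) differentiable (at (snd c p))"
    using assms unfolding smooth_in_chart_def smooth_fun_on_def by blast
  then show ?thesis by (simp add: diff_in_chart_def)
qed

lemma smooth_coord_deriv:
  assumes "smooth_in_chart c h"
  shows "smooth_in_chart c (coord_deriv c i h)"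
  using assms unfolding smooth_in_chart_def
  by (rule smooth_fun_on_partial_deriv[OF open_image]) (auto simp: coord_deriv_def)

lemma coord_deriv_commute:
  assumes h: "smooth_in_chart c h" and p: "p \<in> fst c"
  shows "coord_deriv c i (coord_deriv c j h) p = coord_deriv c j (coord_deriv c i h) p"
proof -
  let ?h = "h \<circ> chart_inv c"
  have eq: "\<forall>\<^sub>F x in nhds (snd c p). (coord_deriv c i h \<circ> chart_inv c) x = partial_deriv i ?h x" for i
  proof -
    have "\<forall>\<^sub>F x in nhds (snd c p). x \<in> snd c ` fst c"
      using p open_image by (intro eventually_nhds_in_open) auto
    then show ?thesis by eventually_elim (auto simp: coord_deriv_def)
  qed
  have "partial_deriv i ?h differentiable (at (snd c p))" for i
  proof -
    have "iter_partial [i] ?h differentiable (at (snd c p))"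
      using h p unfolding smooth_in_chart_def smooth_fun_on_def by blast
    then show ?thesis by simp
  qed
  moreover have "\<forall>\<^sub>F x in nhds (snd c p). ?h differentiable (at x)"
  proof -
    have "\<forall>\<^sub>F x in nhds (snd c p). x \<in> snd c ` fst c"
      using p open_image by (intro eventually_nhds_in_open) auto
    then show ?thesis
      by eventually_elim (use smooth_imp_diff_in_chart[OF h] in \<open>auto simp: diff_in_chart_def\<close>)
  qed
  ultimately show ?thesis
    unfolding coord_deriv_def[of c i "coord_deriv c j h"] coord_deriv_def[of c j "coord_deriv c i h"]
      partial_deriv_cong_ev[OF eq]
    by (intro partial_deriv_commute)
qed

end

section \<open>Levi-Civita connection and symmetries of the curvature\<close>

locale riemannian_chart = chart_domain c
  for c :: "('a::topological_space, 'n::finite) chart" +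
  fixes g :: "('a, 'n) metric_field"
  assumes g_smooth: "smooth_in_chart c (\<lambda>q. g c q $ i $ j)"
    and g_symmetric: "p \<in> fst c \<Longrightarrow> transpose (g c p) = g c p"
    and g_pos: "p \<in> fst c \<Longrightarrow> v \<noteq> 0 \<Longrightarrow> v \<bullet> (g c p *v v) > 0"
begin

abbreviation "G i j p \<equiv> g c p $ i $ j"
abbreviation "K i j p \<equiv> inv_metric g c p $ i $ j"
abbreviation "\<Gamma> \<equiv> christoffel g c"
abbreviation deriv_in_chart ("\<partial>") where "\<partial> \<equiv> coord_deriv c"

lemma g_sym: "p \<in> fst c \<Longrightarrow> G i j p = G j i p"
  using arg_cong[OF g_symmetric[of p], of "\<lambda>M. M $ j $ i"] by (simp add: transpose_def)

lemma det_g: "p \<in> fst c \<Longrightarrow> det (g c p) \<noteq> 0"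
proof -
  assume p: "p \<in> fst c"
  have "x = 0" if "g c p *v x = 0" for x
    using g_pos[OF p, of x] that by auto
  then show ?thesis
    by (simp only: invertible_det_nz[symmetric] invertible_left_inverse matrix_left_invertible_ker) blast
qed

lemma inv_metric_mult:
  assumes "p \<in> fst c"
  shows "inv_metric g c p ** g c p = mat 1" "g c p ** inv_metric g c p = mat 1"
proof -
  have "invertible (g c p)" using det_g[OF assms] by (simp add: invertible_det_nz)
  then have "g c p ** inv_metric g c p = mat 1 \<and> inv_metric g c p ** g c p = mat 1"
    unfolding invertible_def inv_metric_def matrix_inv_def by (rule someI_ex)
  then show "inv_metric g c p ** g c p = mat 1" "g c p ** inv_metric g c p = mat 1" by auto
qed

lemma metric_components:
  assumes p: "p \<in> fst c"
  shows "metric_components (\<lambda>i j. G i j p) (\<lambda>i j. K i j p)"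
proof
  show "G i j p = G j i p" for i j by (rule g_sym[OF p])
  have "transpose (inv_metric g c p) = (inv_metric g c p ** g c p) ** transpose (inv_metric g c p)"
    by (simp add: inv_metric_mult[OF p])
  also have "\<dots> = inv_metric g c p ** transpose (inv_metric g c p ** g c p)"
    by (simp add: matrix_transpose_mul g_symmetric[OF p] matrix_mul_assoc)
  also have "\<dots> = inv_metric g c p"
    by (simp add: inv_metric_mult[OF p])
  finally have "transpose (inv_metric g c p) = inv_metric g c p" .
  from arg_cong[OF this, of "\<lambda>M. M $ j $ i" for i j] show "K i j p = K j i p" for i j
    by (simp add: transpose_def)
  show "(\<Sum>k\<in>UNIV. K i k p * G k j p) = (if i = j then 1 else 0)" for i j
    using arg_cong[OF inv_metric_mult(1)[OF p], of "\<lambda>M. M $ i $ j"]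
    by (simp add: matrix_matrix_mult_def mat_def)
qed

lemma metric_lower_inverse:
  assumes "p \<in> fst c"
  shows "(\<Sum>m\<in>UNIV. G k m p * (\<Sum>l\<in>UNIV. K m l p * X l)) = X k"
proof -
  have "g c p *v (inv_metric g c p *v (\<chi> l. X l)) = (\<chi> l. X l)"
    by (simp add: matrix_vector_mul_assoc inv_metric_mult[OF assms])
  from arg_cong[OF this, of "\<lambda>x. x $ k"] show ?thesis
    by (simp add: matrix_vector_mult_def)
qed

lemma G_diff: "p \<in> fst c \<Longrightarrow> diff_in_chart c (\<lambda>q. G i j q) p"
  by (intro smooth_imp_diff_in_chart g_smooth)

lemma dG_smooth: "smooth_in_chart c (\<partial> k (\<lambda>q. G i j q))"
  by (intro smooth_coord_deriv g_smooth)

lemma K_diff: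
  assumes p: "p \<in> fst c"
  shows "diff_in_chart c (\<lambda>q. K i j q) p"
  unfolding diff_in_chart_def o_def inv_metric_def
proof (rule differentiable_matrix_inv[OF _ open_image])
  show "(\<lambda>x. g c (chart_inv c x) $ i $ j) differentiable (at (snd c p))" for i j
    using G_diff[OF p] by (simp add: diff_in_chart_def o_def)
qed (use p det_g in auto)

lemma christoffel_diff: "p \<in> fst c \<Longrightarrow> diff_in_chart c (\<Gamma> k i j) p"
  unfolding christoffel_def
  by (intro diff_in_chart_intros K_diff smooth_imp_diff_in_chart dG_smooth)

lemma christoffel_sym:
  assumes "p \<in> fst c"
  shows "\<Gamma> k i j p = \<Gamma> k j i p"
proof -
  have "\<partial> l (\<lambda>q. G i j q) p = \<partial> l (\<lambda>q. G j i q) p" for l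
    using assms g_sym by (intro coord_deriv_cong)
  then show ?thesis by (simp add: christoffel_def add_ac)
qed

text \<open>A lowered Christoffel symbol is half a combination of three metric derivatives.
  Exchanging \<open>j\<close> and \<open>k\<close> flips the sign of two of them, so the sum of both
  symbols keeps only the third.\<close>

lemma metric_compatible:
  assumes p: "p \<in> fst c"
  shows "\<partial> i (\<lambda>q. G j k q) p = (\<Sum>m\<in>UNIV. \<Gamma> m i j p * G m k p) + (\<Sum>m\<in>UNIV. \<Gamma> m i k p * G j m p)"
proof -
  have lower: "(\<Sum>m\<in>UNIV. \<Gamma> m i j p * G k m p) =
      1/2 * (\<partial> i (\<lambda>q. G j k q) p + \<partial> j (\<lambda>q. G i k q) p - \<partial> k (\<lambda>q. G i j q) p)" for i j k
    using metric_lower_inverse[OF p, of k "\<lambda>l. 1/2 * (\<partial> i (\<lambda>q. G j l q) p + \<partial> j (\<lambda>q. G i l q) p - \<partial> l (\<lambda>q. G i j q) p)"]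
    unfolding christoffel_def by (simp add: sum_distrib_left mult_ac)
  have sym: "\<partial> l (\<lambda>q. G i j q) p = \<partial> l (\<lambda>q. G j i q) p" for l i j
    using p g_sym by (intro coord_deriv_cong)
  have "(\<Sum>m\<in>UNIV. \<Gamma> m i j p * G m k p) = (\<Sum>m\<in>UNIV. \<Gamma> m i j p * G k m p)"
    by (simp add: g_sym[OF p, of _ k])
  then show ?thesis
    using lower[of i j k] lower[of i k j] sym[of i j k] sym[of j i k] sym[of k i j] by simp
qed

lemma riemann_antisym_first: "riemann g c i j k l p = - riemann g c j i k l p"
  unfolding riemann_def riemann_up_def sum_negf[symmetric]
  by (intro sum.cong refl) (simp add: sum_subtractf algebra_simps)

text \<open>Torsion-freeness: by symmetry of the lower indices of \<open>\<Gamma>\<close>,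
  derivative terms and quadratic terms cancel in pairs.\<close>

lemma riemann_bianchi:
  assumes p: "p \<in> fst c"
  shows "riemann g c i j k l p + riemann g c j l k i p + riemann g c l i k j p = 0"
proof -
  have "riemann_up g c m i j l p + riemann_up g c m j l i p + riemann_up g c m l i j p = 0" for m
  proof -
    have d: "\<partial> i (\<Gamma> m j l) p = \<partial> i (\<Gamma> m l j) p" for i j l
      by (intro coord_deriv_cong christoffel_sym p)
    show ?thesis
      unfolding riemann_up_def
      using d[of i j l] d[of j i l] d[of l i j]
      by (simp add: sum_subtractf christoffel_sym[OF p, of _ l j] christoffel_sym[OF p, of _ l i]
          christoffel_sym[OF p, of _ j i])
  qed
  then have "(\<Sum>m\<in>UNIV. G k m p * (riemann_up g c m i j l p + riemann_up g c m j l i p + riemann_up g c m l i j p)) = 0"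
    by simp
  then show ?thesis
    by (simp add: riemann_def distrib_left sum.distrib)
qed

text \<open>Antisymmetrise the second derivative of the metric, expanded by metric compatibility.\<close>

lemma riemann_antisym_last:
  assumes p: "p \<in> fst c"
  shows "riemann g c l i k j p = - riemann g c l i j k p"
proof -
  \<comment> \<open>\<open>X\<close> antisymmetrises in \<open>l\<close> and \<open>i\<close> to the
    curvature. \<open>Z\<close> is unchanged when both \<open>l\<close>, \<open>i\<close> and
    \<open>j\<close>, \<open>k\<close> are exchanged, so its contributions cancel.\<close>
  define X where "X l i j k = (\<Sum>m\<in>UNIV. G k m p * (\<partial> l (\<Gamma> m i j) p + (\<Sum>s\<in>UNIV. \<Gamma> s i j p * \<Gamma> m l s p)))" for l i j k
  define Z where "Z l i j k = (\<Sum>m\<in>UNIV. \<Sum>s\<in>UNIV. \<Gamma> m i j p * \<Gamma> s l k p * G m s p)" for l i j k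
  have R: "riemann g c l i k j p = X l i j k - X i l j k" for l i j k
    unfolding riemann_def riemann_up_def X_def sum_subtractf[symmetric]
    by (intro sum.cong refl) (simp add: sum_subtractf algebra_simps)
  have Zsym: "Z l i k j = Z i l j k" for l i j k
    unfolding Z_def by (subst sum.swap) (simp add: g_sym[OF p] mult_ac)
  have half: "\<partial> l (\<lambda>q. \<Sum>m\<in>UNIV. \<Gamma> m i j q * G m k q) p = X l i j k + Z l i j k" for l i j k
  proof -
    have "\<partial> l (\<lambda>q. \<Sum>m\<in>UNIV. \<Gamma> m i j q * G m k q) p =
        (\<Sum>m\<in>UNIV. \<Gamma> m i j p * \<partial> l (\<lambda>q. G m k q) p + \<partial> l (\<Gamma> m i j) p * G m k p)"
      by (subst coord_deriv_sum)
         (auto intro!: diff_in_chart_intros christoffel_diff G_diff p sum.cong coord_deriv_mult)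
    also have "\<dots> = (\<Sum>m\<in>UNIV. \<partial> l (\<Gamma> m i j) p * G m k p)
        + (\<Sum>m\<in>UNIV. \<Sum>s\<in>UNIV. \<Gamma> m i j p * \<Gamma> s l m p * G s k p) + Z l i j k"
      unfolding metric_compatible[OF p] Z_def
      by (simp add: sum.distrib distrib_left sum_distrib_left mult_ac)
    also have "(\<Sum>m\<in>UNIV. \<Sum>s\<in>UNIV. \<Gamma> m i j p * \<Gamma> s l m p * G s k p)
        = (\<Sum>m\<in>UNIV. \<Sum>s\<in>UNIV. G k m p * (\<Gamma> s i j p * \<Gamma> m l s p))"
      by (subst sum.swap) (simp add: g_sym[OF p, of _ k] mult_ac)
    finally show ?thesis
      by (simp add: X_def sum.distrib distrib_left sum_distrib_left g_sym[OF p, of _ k] mult_ac)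
  qed
  have second: "\<partial> l (\<partial> i (\<lambda>q. G j k q)) p = X l i j k + Z l i j k + (X l i k j + Z l i k j)" for l i j k
  proof -
    have "\<partial> l (\<partial> i (\<lambda>q. G j k q)) p
        = \<partial> l (\<lambda>q. (\<Sum>m\<in>UNIV. \<Gamma> m i j q * G m k q) + (\<Sum>m\<in>UNIV. \<Gamma> m i k q * G m j q)) p"
      by (rule coord_deriv_cong[OF p]) (simp add: metric_compatible g_sym[of _ j])
    also have "\<dots> = X l i j k + Z l i j k + (X l i k j + Z l i k j)"
      by (subst coord_deriv_add) (auto intro!: diff_in_chart_intros christoffel_diff G_diff p simp: half)
    finally show ?thesis .
  qed
  have "\<partial> l (\<partial> i (\<lambda>q. G j k q)) p = \<partial> i (\<partial> l (\<lambda>q. G j k q)) p"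
    by (rule coord_deriv_commute[OF g_smooth p])
  then show ?thesis
    unfolding second R using Zsym[of l i j k] Zsym[of l i k j] by simp
qed

lemma riemann_pair_sym:
  assumes "p \<in> fst c"
  shows "riemann g c i j k l p = riemann g c k l i j p"
  using riemann_antisym_first riemann_antisym_last[OF assms] riemann_bianchi[OF assms]
  by (rule curvature_pair_symmetry[of "\<lambda>i j k l. riemann g c i j k l p"])

lemma ricci_eq_tr:
  assumes "p \<in> fst c"
  shows "ricci g c i k p = metric_components.tr (\<lambda>i j. K i j p) (\<lambda>j l. riemann g c i j k l p)"
  by (simp add: ricci_def metric_components.tr_def[OF metric_components[OF assms]])

lemma ricci_sym:
  assumes p: "p \<in> fst c"
  shows "ricci g c i k p = ricci g c k i p"
proof -
  interpret metric_components "\<lambda>i j. G i j p" "\<lambda>i j. K i j p" by (rule metric_components[OF p])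
  show ?thesis
    unfolding ricci_eq_tr[OF p] riemann_pair_sym[OF p, of i _ k]
    using tr_transpose[of "\<lambda>j l. riemann g c k j i l p"] by simp
qed

end

section \<open>Hessian of a function and the Ricci identity\<close>

locale riemannian_chart_function = riemannian_chart c g
  for c :: "('a::topological_space, 'n::finite) chart" and g +
  fixes f :: "'a \<Rightarrow> real"
  assumes f_smooth: "smooth_in_chart c f"
begin

abbreviation "df i \<equiv> \<partial> i f"

lemma df_diff: "p \<in> fst c \<Longrightarrow> diff_in_chart c (df i) p"
  by (intro smooth_imp_diff_in_chart smooth_coord_deriv f_smooth)

lemma ddf_diff: "p \<in> fst c \<Longrightarrow> diff_in_chart c (\<partial> i (df j)) p"
  by (intro smooth_imp_diff_in_chart smooth_coord_deriv f_smooth)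

lemma hessian_diff: "p \<in> fst c \<Longrightarrow> diff_in_chart c (hessian g f c i j) p"
  unfolding hessian_def by (intro diff_in_chart_intros ddf_diff christoffel_diff df_diff)

lemma df_eq: "\<partial> i (df j) p = hessian g f c i j p + (\<Sum>m\<in>UNIV. \<Gamma> m i j p * df m p)"
  by (simp add: hessian_def)

lemma gradient_eq_raise:
  assumes "p \<in> fst c"
  shows "gradient g f c p $ i = metric_components.raise (\<lambda>i j. K i j p) (\<lambda>i. df i p) i"
  by (simp add: gradient_def metric_components.raise_def[OF metric_components[OF assms]])

text \<open>The right-hand side is \<open>\<nabla>\<^sub>i\<nabla>\<^sub>j\<nabla>\<^sub>k f - \<nabla>\<^sub>j\<nabla>\<^sub>i\<nabla>\<^sub>k f\<close>.\<close>

lemma ricci_identity: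
  assumes p: "p \<in> fst c"
  shows "(\<Sum>l\<in>UNIV. riemann g c i j k l p * gradient g f c p $ l) =
    \<partial> i (hessian g f c j k) p - \<partial> j (hessian g f c i k) p
    - (\<Sum>m\<in>UNIV. \<Gamma> m i k p * hessian g f c j m p) + (\<Sum>m\<in>UNIV. \<Gamma> m j k p * hessian g f c i m p)"
proof -
  \<comment> \<open>The third covariant derivatives also contain \<open>\<Gamma> m i j\<close> times
    the Hessian; this is symmetric in \<open>i\<close> and \<open>j\<close>, hence absent from the
    claim.\<close>
  have d: "\<partial> i (hessian g f c j k) p = \<partial> i (\<partial> j (df k)) p
      - (\<Sum>m\<in>UNIV. \<Gamma> m j k p * \<partial> i (df m) p + \<partial> i (\<Gamma> m j k) p * df m p)" for i j k
    unfolding hessian_def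
    by (subst coord_deriv_diff coord_deriv_sum,
        auto intro!: diff_in_chart_intros ddf_diff df_diff christoffel_diff p)+
       (auto intro!: sum.cong coord_deriv_mult christoffel_diff df_diff p)
  have dd: "\<partial> i (\<partial> j (df k)) p = \<partial> j (\<partial> i (df k)) p"
    by (intro coord_deriv_commute smooth_coord_deriv f_smooth p)
  define Y where "Y i j k = (\<Sum>m\<in>UNIV. \<Sum>s\<in>UNIV. \<Gamma> s i k p * \<Gamma> m j s p * df m p)" for i j k
  have swap: "(\<Sum>s\<in>UNIV. \<Gamma> s i k p * (\<Sum>m\<in>UNIV. \<Gamma> m j s p * df m p)) = Y i j k" for i j k
    unfolding Y_def sum_distrib_left by (subst sum.swap) (simp add: mult_ac)
  have "(\<Sum>m\<in>UNIV. df m p * riemann_up g c m i j k p) =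
      (\<Sum>m\<in>UNIV. \<partial> i (\<Gamma> m j k) p * df m p) - (\<Sum>m\<in>UNIV. \<partial> j (\<Gamma> m i k) p * df m p)
      + Y j i k - Y i j k"
    unfolding riemann_up_def Y_def
    by (simp add: algebra_simps sum.distrib sum_subtractf sum_distrib_left)
  \<comment> \<open>\<open>riemann\<close> lowers its upper index into the third slot whereas the
    gradient sits in the fourth; exchanging the two costs the sign.\<close>
  moreover have "(\<Sum>l\<in>UNIV. riemann g c i j k l p * gradient g f c p $ l)
      = - (\<Sum>m\<in>UNIV. df m p * riemann_up g c m i j k p)"
  proof -
    have "(\<Sum>l\<in>UNIV. riemann g c i j k l p * gradient g f c p $ l)
        = - (\<Sum>l\<in>UNIV. riemann g c i j l k p * gradient g f c p $ l)"
      unfolding riemann_antisym_last[OF p, of i j k] by (simp add: sum_negf)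
    also have "(\<Sum>l\<in>UNIV. riemann g c i j l k p * gradient g f c p $ l)
        = (\<Sum>m\<in>UNIV. (\<Sum>l\<in>UNIV. G m l p * gradient g f c p $ l) * riemann_up g c m i j k p)"
      unfolding riemann_def sum_distrib_right
      by (subst sum.swap) (simp add: g_sym[OF p] mult_ac)
    also have "\<dots> = (\<Sum>m\<in>UNIV. df m p * riemann_up g c m i j k p)"
      by (simp add: gradient_def metric_lower_inverse[OF p])
    finally show ?thesis .
  qed
  ultimately show ?thesis
    unfolding d dd hessian_def[of g f c j] hessian_def[of g f c i]
    by (simp add: sum.distrib sum_subtractf right_diff_distrib swap)
qed

end

section \<open>Solitons with vanishing D\<close>

locale soliton_chart = riemannian_chart_function c g f
  for c :: "('a::topological_space, 4) chart" and g f +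
  assumes soliton: "p \<in> fst c \<Longrightarrow> ricci g c i j p + hessian g f c i j p = 1/2 * g c p $ i $ j"
    and D_zero: "p \<in> fst c \<Longrightarrow> D_tensor g f c i j k p = 0"
begin

abbreviation "v i p \<equiv> gradient g f c p $ i"
abbreviation "Rc i j p \<equiv> ricci g c i j p"
abbreviation "S \<equiv> scalar_curv g c"

text \<open>
  \<open>F = |\<nabla>f|\<^sup>2\<close>; \<open>lam\<close> is the Ricci eigenvalue in the direction \<open>\<nabla>f\<close>, \<open>mu\<close> the one on its orthogonal
  complement. Where \<open>\<nabla>f = 0\<close>, the values of \<open>lam\<close>, \<open>mu\<close> and \<open>nu\<close> are junk (division by 0).
\<close>

definition "F p = (\<Sum>i\<in>UNIV. df i p * v i p)"
definition "lam p = (\<Sum>j\<in>UNIV. (\<Sum>k\<in>UNIV. Rc j k p * v k p) * v j p) / F p"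
definition "mu p = (S p - lam p) / 3"
definition "nu p = (4 * lam p - S p) / (3 * F p)"

text \<open>The definition of \<open>ricci\<close> would require second derivatives of the inverse
  metric; the soliton equation replaces it by terms in \<open>\<Gamma>\<close> and derivatives of
  \<open>f\<close>.\<close>

lemma ricci_diff:
  assumes p: "p \<in> fst c"
  shows "diff_in_chart c (ricci g c i j) p"
proof (rule diff_in_chart_cong[OF p])
  show "diff_in_chart c (\<lambda>q. 1/2 * G i j q - hessian g f c i j q) p"
    by (intro diff_in_chart_intros G_diff hessian_diff p)
  show "1/2 * G i j q - hessian g f c i j q = Rc i j q" if "q \<in> fst c" for q
    using soliton[OF that, of i j] by simp
qed

lemma gradient_diff: "p \<in> fst c \<Longrightarrow> diff_in_chart c (\<lambda>q. v i q) p"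
  unfolding gradient_def vec_lambda_beta by (intro diff_in_chart_intros K_diff df_diff)

lemma F_diff: "p \<in> fst c \<Longrightarrow> diff_in_chart c F p"
  unfolding F_def[abs_def] by (intro diff_in_chart_intros gradient_diff df_diff)

lemma scalar_curv_diff: "p \<in> fst c \<Longrightarrow> diff_in_chart c S p"
  unfolding scalar_curv_def[abs_def] by (intro diff_in_chart_intros K_diff ricci_diff)

lemma lam_diff: "p \<in> fst c \<Longrightarrow> F p \<noteq> 0 \<Longrightarrow> diff_in_chart c lam p"
  unfolding lam_def[abs_def]
  by (intro diff_in_chart_divide diff_in_chart_intros gradient_diff ricci_diff F_diff)

lemma mu_diff: "p \<in> fst c \<Longrightarrow> F p \<noteq> 0 \<Longrightarrow> diff_in_chart c mu p"
  unfolding mu_def[abs_def]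
  by (intro diff_in_chart_divide diff_in_chart_intros lam_diff scalar_curv_diff) simp_all

lemma nu_diff: "p \<in> fst c \<Longrightarrow> F p \<noteq> 0 \<Longrightarrow> diff_in_chart c nu p"
  unfolding nu_def[abs_def]
  by (intro diff_in_chart_divide diff_in_chart_intros lam_diff scalar_curv_diff F_diff) simp_all

lemma contract_gradient:
  assumes "p \<in> fst c"
  shows "contract (metric_components.raise (\<lambda>i j. K i j p) (\<lambda>i. df i p)) X = (\<Sum>k\<in>UNIV. X k * v k p)"
  by (simp add: contract_def gradient_eq_raise[OF assms])

lemma metric_components_4:
  assumes p: "p \<in> fst c" "F p \<noteq> 0"
  shows "metric_components_4 (\<lambda>i j. G i j p) (\<lambda>i j. K i j p) (\<lambda>i. df i p)"
  using metric_components[OF p(1)] p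
  by (simp add: metric_components_4_def metric_components_4_axioms_def contract_gradient F_def)

lemma
  assumes p: "p \<in> fst c" "F p \<noteq> 0"
  shows ricci_gradient: "(\<Sum>k\<in>UNIV. Rc i k p * v k p) = lam p * df i p"
    and ricci_eigenspaces: "Rc j k p = mu p * G j k p + nu p * (df j p * df k p)"
proof -
  interpret metric_components_4 "\<lambda>i j. G i j p" "\<lambda>i j. K i j p" "\<lambda>i. df i p"
    by (rule metric_components_4[OF p])
  have trRc: "tr (\<lambda>i j. Rc i j p) = S p"
    by (simp add: tr_def scalar_curv_def)
  \<comment> \<open>1/2, 1/12 and 1/6 are \<open>1 / (n - 2)\<close>,
    \<open>1 / (2 * (n - 1) * (n - 2))\<close> and \<open>1 / ((n - 1) * (n - 2))\<close> at
    \<open>n = 4\<close>.\<close>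
  have D: "1/2 * (Rc j k p * df i p - Rc i k p * df j p) + 1/12 * (G j k p * \<partial> i S p - G i k p * \<partial> j S p)
              - tr (\<lambda>i j. Rc i j p) / 6 * (G j k p * df i p - G i k p * df j p) = 0" for i j k
    using D_zero[OF p(1), of i j k] by (simp add: D_tensor_def Let_def trRc)
  note shape = ricci_from_D_zero[of "\<lambda>i j. Rc i j p" "\<lambda>i. \<partial> i S p", OF ricci_sym[OF p(1)] D,
      unfolded trRc contract_gradient[OF p(1)], folded F_def, folded lam_def, folded mu_def nu_def]
  show "(\<Sum>k\<in>UNIV. Rc i k p * v k p) = lam p * df i p" by (rule shape(1))
  show "Rc j k p = mu p * G j k p + nu p * (df j p * df k p)" by (rule shape(2))
qed

text \<open>The eigenvalue formulas hold only where \<open>F\<close> is nonzero, and differentiating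
  them at \<open>p\<close> needs them nearby.\<close>

lemma eventually_F_nonzero:
  assumes p: "p \<in> fst c" "F p \<noteq> 0"
  shows "\<forall>\<^sub>F x in nhds (snd c p). x \<in> snd c ` fst c \<and> F (chart_inv c x) \<noteq> 0"
proof (rule eventually_conj)
  show "\<forall>\<^sub>F x in nhds (snd c p). x \<in> snd c ` fst c"
    using p(1) open_image by (intro eventually_nhds_in_open) auto
  have "isCont (F \<circ> chart_inv c) (snd c p)"
    using F_diff[OF p(1)] unfolding diff_in_chart_def by (rule differentiable_imp_continuous_within)
  then have "((F \<circ> chart_inv c) \<longlongrightarrow> F p) (nhds (snd c p))"
    unfolding isCont_def tendsto_at_iff_tendsto_nhds using p(1) by simp
  from tendsto_imp_eventually_ne[OF this p(2)]
  show "\<forall>\<^sub>F x in nhds (snd c p). F (chart_inv c x) \<noteq> 0" by simp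
qed

lemma hessian_eigenspaces:
  assumes p: "p \<in> fst c" "F p \<noteq> 0"
  shows "hessian g f c j k p = (1/2 - mu p) * G j k p - nu p * (df j p * df k p)"
  using soliton[OF p(1), of j k] ricci_eigenspaces[OF p, of j k] by (simp add: algebra_simps)

lemma coord_deriv_hessian:
  assumes p: "p \<in> fst c" "F p \<noteq> 0"
  shows "\<partial> i (hessian g f c j k) p =
      (1/2 - mu p) * \<partial> i (\<lambda>q. G j k q) p - \<partial> i mu p * G j k p
      - nu p * (df j p * \<partial> i (df k) p + \<partial> i (df j) p * df k p) - \<partial> i nu p * (df j p * df k p)"
proof -
  have "\<partial> i (hessian g f c j k) p = \<partial> i (\<lambda>q. (1/2 - mu q) * G j k q - nu q * (df j q * df k q)) p"
    using eventually_F_nonzero[OF p]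
    by (intro coord_deriv_cong_ev) (elim eventually_mono, auto simp: hessian_eigenspaces)
  also have "\<dots> = \<partial> i (\<lambda>q. (1/2 - mu q) * G j k q) p - \<partial> i (\<lambda>q. nu q * (df j q * df k q)) p"
    by (intro coord_deriv_diff diff_in_chart_intros mu_diff nu_diff G_diff df_diff p)
  also have "\<partial> i (\<lambda>q. (1/2 - mu q) * G j k q) p
      = (1/2 - mu p) * \<partial> i (\<lambda>q. G j k q) p + \<partial> i (\<lambda>q. 1/2 - mu q) p * G j k p"
    by (intro coord_deriv_mult diff_in_chart_intros mu_diff G_diff p)
  also have "\<partial> i (\<lambda>q. 1/2 - mu q) p = - \<partial> i mu p"
    by (subst coord_deriv_diff) (auto intro!: diff_in_chart_intros mu_diff p simp: coord_deriv_const)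
  also have "\<partial> i (\<lambda>q. nu q * (df j q * df k q)) p
      = nu p * \<partial> i (\<lambda>q. df j q * df k q) p + \<partial> i nu p * (df j p * df k p)"
    by (intro coord_deriv_mult diff_in_chart_intros nu_diff df_diff p)
  also have "\<partial> i (\<lambda>q. df j q * df k q) p = df j p * \<partial> i (df k) p + \<partial> i (df j) p * df k p"
    by (intro coord_deriv_mult df_diff p)
  finally show ?thesis by simp
qed

lemma riemann_gradient:
  assumes p: "p \<in> fst c" "F p \<noteq> 0"
  shows "(\<Sum>l\<in>UNIV. riemann g c i j k l p * v l p) = - (lam p / 3) * (df i p * G j k p - df j p * G i k p)"
proof -
  interpret metric_components_4 "\<lambda>i j. G i j p" "\<lambda>i j. K i j p" "\<lambda>i. df i p"
    by (rule metric_components_4[OF p])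
  define T where "T i j k = (\<Sum>l\<in>UNIV. riemann g c i j k l p * v l p)" for i j k
  \<comment> \<open>Coefficient of the metric: besides the derivative of \<open>mu\<close> it
    receives the metric part of the Hessian inside
    \<open>nu p * (df i p * hessian g f c j k p)\<close>. The part quadratic in \<open>nu\<close> is
    symmetric in \<open>i\<close> and \<open>j\<close> and cancels.\<close>
  define \<alpha> where "\<alpha> i = nu p * (1/2 - mu p) * df i p - \<partial> i mu p" for i
  have half: "\<partial> i (hessian g f c j k) p - (\<Sum>m\<in>UNIV. \<Gamma> m i k p * hessian g f c j m p) =
      (1/2 - mu p) * (\<Sum>m\<in>UNIV. \<Gamma> m i j p * G m k p) - \<partial> i mu p * G j k p
      - nu p * (df j p * hessian g f c i k p + \<partial> i (df j) p * df k p) - \<partial> i nu p * (df j p * df k p)"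
    for i j k
  proof -
    have "(\<Sum>m\<in>UNIV. \<Gamma> m i k p * hessian g f c j m p) =
        (1/2 - mu p) * (\<Sum>m\<in>UNIV. \<Gamma> m i k p * G j m p) - nu p * (df j p * (\<Sum>m\<in>UNIV. \<Gamma> m i k p * df m p))"
      unfolding hessian_eigenspaces[OF p]
      by (simp only: right_diff_distrib sum_subtractf sum_distrib_left mult_ac)
    then show ?thesis
      unfolding coord_deriv_hessian[OF p] metric_compatible[OF p(1)] df_eq[of i k]
      by (simp add: algebra_simps)
  qed
  have T: "T i j k = \<alpha> i * G j k p - \<alpha> j * G i k p - (\<partial> i nu p * df j p - \<partial> j nu p * df i p) * df k p" for i j k
  proof -
    have "(\<Sum>m\<in>UNIV. \<Gamma> m i j p * G m k p) = (\<Sum>m\<in>UNIV. \<Gamma> m j i p * G m k p)"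
      by (simp add: christoffel_sym[OF p(1), of _ i j])
    moreover have "\<partial> i (df j) p = \<partial> j (df i) p"
      by (rule coord_deriv_commute[OF f_smooth p(1)])
    ultimately show ?thesis
      using half[of i j k] half[of j i k]
      unfolding T_def ricci_identity[OF p(1)] hessian_eigenspaces[OF p, of i k] hessian_eigenspaces[OF p, of j k]
      by (simp add: \<alpha>_def algebra_simps)
  qed
  \<comment> \<open>The curvature is antisymmetric in \<open>k\<close> and \<open>l\<close>, the
    product of gradient components symmetric.\<close>
  have "contract (raise (\<lambda>i. df i p)) (T i j) = 0" for i j
  proof -
    have "(\<Sum>k\<in>UNIV. T i j k * v k p) = (\<Sum>k\<in>UNIV. \<Sum>l\<in>UNIV. riemann g c i j k l p * (v l p * v k p))"
      by (simp add: T_def sum_distrib_left sum_distrib_right mult_ac)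
    also have "\<dots> = (\<Sum>l\<in>UNIV. \<Sum>k\<in>UNIV. riemann g c i j k l p * (v l p * v k p))"
      by (rule sum.swap)
    also have "\<dots> = - (\<Sum>k\<in>UNIV. T i j k * v k p)"
      unfolding T_def sum_distrib_right sum_negf[symmetric]
      by (intro sum.cong refl, subst riemann_antisym_last[OF p(1)]) simp
    finally show ?thesis by (simp add: contract_gradient[OF p(1)])
  qed
  moreover have "tr (T i) = - lam p * df i p" for i
  proof -
    \<comment> \<open>This trace pairs the second slot with the third and not with the fourth, so
      the Ricci tensor appears with a minus sign.\<close>
    have trR: "tr (\<lambda>j k. riemann g c i j k l p) = - Rc i l p" for l
      unfolding ricci_eq_tr[OF p(1)] tr_linear(3)[symmetric] by (subst riemann_antisym_last[OF p(1)]) simp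
    have "tr (T i) = (\<Sum>l\<in>UNIV. tr (\<lambda>j k. riemann g c i j k l p) * v l p)"
      unfolding tr_def T_def sum_distrib_left sum_distrib_right
      by (subst sum_rotate3) (simp add: mult_ac)
    also have "\<dots> = - lam p * df i p"
      by (simp add: trR sum_negf ricci_gradient[OF p])
    finally show ?thesis .
  qed
  ultimately show ?thesis
    unfolding T_def[symmetric] using curvature_contraction_rigid[OF T] by blast
qed

lemma weyl_4:
  "weyl g c i j k l p = riemann g c i j k l p
     - 1/2 * (G i k p * Rc j l p - G i l p * Rc j k p - G j k p * Rc i l p + G j l p * Rc i k p)
     + S p / 6 * (G i k p * G j l p - G i l p * G j k p)"
  by (simp add: weyl_def Let_def)

text \<open>The \<open>nu\<close> parts cancel by antisymmetry in \<open>i\<close> and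
  \<open>j\<close>, and the coefficient of \<open>df i p * G j k p\<close> is
  \<open>- lam p / 3 + mu p / 2 + lam p / 2 - S p / 6\<close>, which vanishes by the definition of
  \<open>mu\<close>.\<close>

lemma weyl_gradient:
  assumes p: "p \<in> fst c" "F p \<noteq> 0"
  shows "(\<Sum>l\<in>UNIV. weyl g c i j k l p * v l p) = 0"
proof -
  interpret metric_components_4 "\<lambda>i j. G i j p" "\<lambda>i j. K i j p" "\<lambda>i. df i p"
    by (rule metric_components_4[OF p])
  have Rm: "contract (raise (\<lambda>i. df i p)) (\<lambda>l. riemann g c i j k l p)
      = - (lam p / 3) * (df i p * G j k p - df j p * G i k p)"
    unfolding contract_gradient[OF p(1)] by (rule riemann_gradient[OF p])
  have Rcv: "contract (raise (\<lambda>i. df i p)) (\<lambda>l. Rc j l p) = lam p * df j p" for j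
    unfolding contract_gradient[OF p(1)] by (rule ricci_gradient[OF p])
  have "contract (raise (\<lambda>i. df i p)) (\<lambda>l. weyl g c i j k l p)
      = - (lam p / 3) * (df i p * G j k p - df j p * G i k p)
      - 1/2 * (G i k p * (lam p * df j p) - df i p * Rc j k p - G j k p * (lam p * df i p) + df j p * Rc i k p)
     + S p / 6 * (G i k p * df j p - df i p * G j k p)"
    unfolding weyl_4 by (simp add: Rm Rcv)
  also have "\<dots> = 0"
    unfolding ricci_eigenspaces[OF p, of j k] ricci_eigenspaces[OF p, of i k] mu_def
    by (simp add: field_simps)
  finally show ?thesis
    by (simp add: contract_gradient[OF p(1)])
qed

lemma weyl_vanishes:
  assumes p: "p \<in> fst c" and v: "gradient g f c p \<noteq> 0"
  shows "weyl g c i j k l p = 0"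
proof -
  have "df i p = (\<Sum>j\<in>UNIV. G i j p * v j p)" for i
    by (simp add: gradient_def metric_lower_inverse[OF p])
  \<comment> \<open>Identifies \<open>F\<close> as a metric square, so that positive definiteness
    excludes zero.\<close>
  then have "F p = gradient g f c p \<bullet> (g c p *v gradient g f c p)"
    by (simp add: F_def inner_vec_def matrix_vector_mult_def mult.commute)
  then have F: "F p \<noteq> 0"
    using g_pos[OF p v] by simp
  interpret metric_components_4 "\<lambda>i j. G i j p" "\<lambda>i j. K i j p" "\<lambda>i. df i p"
    by (rule metric_components_4[OF p F])
  show ?thesis
  proof (rule weyl_type_vanishes_4[where W = "\<lambda>i j k l. weyl g c i j k l p",
        OF g_symmetric[OF p] g_pos[OF p] v inv_metric_mult(1)[OF p]])
    show "weyl g c i j k l p = - weyl g c j i k l p" for i j k l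
      unfolding weyl_4 using riemann_antisym_first[of i j k l p] by (simp add: algebra_simps)
    show "weyl g c i j k l p = - weyl g c i j l k p" for i j k l
      unfolding weyl_4 using riemann_antisym_last[OF p, of i j k l] by (simp add: algebra_simps)
    show "weyl g c i j k l p = weyl g c k l i j p" for i j k l
      unfolding weyl_4 using riemann_pair_sym[OF p, of i j k l]
      by (simp add: algebra_simps ricci_sym[OF p, of k] ricci_sym[OF p, of l] g_sym[OF p, of k] g_sym[OF p, of l])
    have trRc: "tr (\<lambda>i j. Rc i j p) = S p"
      by (simp add: tr_def scalar_curv_def)
    \<comment> \<open>In dimension 4 the Ricci terms carry 1 - (4 - 2)/2 = 0 and the metric terms
      \<open>- S p / 2 + 3 * S p / 6\<close>.\<close>
    have "tr (\<lambda>j l. weyl g c i j k l p) = 0" for i k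
      unfolding weyl_4
      by (simp add: ricci_eq_tr[OF p, symmetric] trRc ricci_sym[OF p, of k] g_sym[OF p, of k])
         (simp add: field_simps)
    then show "(\<Sum>j\<in>UNIV. \<Sum>l\<in>UNIV. K j l p * weyl g c i j k l p) = 0" for i k
      by (simp add: tr_def)
    show "(\<Sum>l\<in>UNIV. weyl g c i j k l p * v l p) = 0" for i j k
      by (rule weyl_gradient[OF p F])
  qed
qed

end

theorem lemma4p3:
  fixes A :: "('a::{t2_space, second_countable_topology}, 4) chart set"
    and g :: "('a, 4) metric_field"
    and f :: "'a \<Rightarrow> real"
  assumes soliton: "complete_gradient_shrinking_soliton A g f"
    and D_zero: "\<forall>c\<in>A. \<forall>p\<in>fst c. \<forall>i j k. D_tensor g f c i j k p = 0"
  shows "\<forall>c\<in>A. \<forall>p\<in>fst c. gradient g f c p \<noteq> 0 \<longrightarrow> (\<forall>i j k l. weyl g c i j k l p = 0)"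
proof (intro ballI impI allI)
  fix c p i j k l
  assume c: "c \<in> A" and p: "p \<in> fst c" and v: "gradient g f c p \<noteq> 0"
  interpret soliton_chart c g f
    using soliton D_zero c
    unfolding complete_gradient_shrinking_soliton_def smooth_atlas_def riemannian_metric_def
      smooth_scalar_field_def
    by unfold_locales (auto simp: smooth_in_chart_def o_def)
  show "weyl g c i j k l p = 0"
    by (rule weyl_vanishes[OF p v])
qed

end
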